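(* For any $\varepsilon>0$, there exist constants $A,B>0$ and $\alpha,\beta>0$ (depending only on $\varepsilon$) such that for all $n\ge1$, $$Be^{-\beta n}\le\lambda\left\{x\in[0,1):\left|\frac{\log q_n(x)}{n}-\frac{\pi^2}{12\log2}\right|\ge\varepsilon\right\}\le Ae^{-\alpha n}.$$
   Context: $\lambda$ is Lebesgue measure on $[0,1)$. Every irrational $x\in[0,1)$ has a unique regular continued fraction expansion $x=[a_1(x),a_2(x),\dots]=\cfrac{1}{a_1(x)+\cfrac{1}{a_2(x)+\cdots}}$ with positive integers $a_n(x)$, where $a_1(x)=\lfloor 1/x\rfloor$, $a_{n+1}(x)=a_1(T^n x)$, $T(0)=0$, $T(x)=1/x-\lfloor 1/x\rfloor$ for $x\in(0,1)$. $q_n(x)$ is the denominator of the $n$-th convergent $p_n(x)/q_n(x)=[a_1(x),\dots,a_n(x)]$ in lowest terms; equivalently $q_{-1}=0$, $q_0=1$, $q_n=a_nq_{n-1}+q_{n-2}$. Rational $x$ (finite expansions) form a $\lambda$-null set and may be ignored in the sets measured. *)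

theory Defs
  imports "HOL-Analysis.Analysis"
begin

definition gauss_map :: "real \<Rightarrow> real" where
  "gauss_map x = (if x = 0 then 0 else 1 / x - of_int \<lfloor>1 / x\<rfloor>)"

text \<open>Digits are indexed from 1. The digit of a point whose orbit has reached 0 is
  0, since \<open>1 / 0 = 0\<close>.\<close>

definition cf_digit :: "nat \<Rightarrow> real \<Rightarrow> int" where
  "cf_digit n x = \<lfloor>1 / (gauss_map ^^ (n - 1)) x\<rfloor>"

fun cf_value :: "int list \<Rightarrow> rat" where
  "cf_value [] = 0"
| "cf_value (a # as) = 1 / (of_int a + cf_value as)"

text \<open>For rational \<open>x\<close> the digits are eventually 0. As \<open>1 / (0 + 0) = 0\<close>, trailing
  zeros do not change the value of a finite continued fraction, so the convergents are
  then eventually constant, equal to \<open>x\<close>.\<close>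

definition cf_convergent :: "nat \<Rightarrow> real \<Rightarrow> rat" where
  "cf_convergent n x = cf_value (map (\<lambda>k. cf_digit k x) [1..<Suc n])"

definition cf_denom :: "nat \<Rightarrow> real \<Rightarrow> int" where
  "cf_denom n x = snd (quotient_of (cf_convergent n x))"

text \<open>The recurrence for the denominators at irrational points.\<close>

fun cf_cont :: "int list \<Rightarrow> int \<times> int" where
  "cf_cont [] = (0, 1)"
| "cf_cont (a # as) = (let (p, q) = cf_cont as in (q, a * q + p))"

lemma cf_cont_coprime:
  "coprime (fst (cf_cont as)) (snd (cf_cont as))"
proof (induction as)
  case (Cons a as)
  obtain p q where pq: "cf_cont as = (p, q)" by fastforce
  have "gcd q (a * q + p) = gcd q p"
    using gcd_add_mult[of q a p] by simp
  with Cons pq show ?case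
    by (simp add: coprime_iff_gcd_eq_1 gcd.commute)
qed simp

lemma cf_cont_pos:
  "(\<forall>a\<in>set as. a \<ge> 1) \<Longrightarrow> fst (cf_cont as) \<ge> 0 \<and> snd (cf_cont as) > 0"
proof (induction as)
  case (Cons a as)
  then have "a * snd (cf_cont as) > 0" by simp
  with Cons show ?case by (simp add: case_prod_beta Let_def add_pos_nonneg)
qed simp

lemma cf_value_cont:
  "(\<forall>a\<in>set as. a \<ge> 1) \<Longrightarrow>
     cf_value as = of_int (fst (cf_cont as)) / of_int (snd (cf_cont as))"
proof (induction as)
  case (Cons a as)
  then have "snd (cf_cont as) > 0" using cf_cont_pos by simp
  then have "(of_int (snd (cf_cont as)) :: rat) \<noteq> 0" by simp
  then have "of_int a + (of_int (fst (cf_cont as)) :: rat) / of_int (snd (cf_cont as))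
      = (of_int a * of_int (snd (cf_cont as)) + of_int (fst (cf_cont as)))
          / of_int (snd (cf_cont as))"
    by (simp add: add_divide_distrib)
  with Cons show ?case by (simp add: case_prod_beta Let_def)
qed simp

lemma cf_cont_append:
  "snd (cf_cont (as @ [b, c])) = c * snd (cf_cont (as @ [b])) + snd (cf_cont as) \<and>
   fst (cf_cont (as @ [b, c])) = c * fst (cf_cont (as @ [b])) + fst (cf_cont as)"
  by (induction as) (auto simp: case_prod_beta Let_def algebra_simps)

lemma cf_denom_cont:
  assumes "\<forall>a\<in>set as. a \<ge> 1"
  shows "snd (quotient_of (cf_value as)) = snd (cf_cont as)"
proof -
  have "cf_value as = Fract (fst (cf_cont as)) (snd (cf_cont as))"
    using cf_value_cont[OF assms] by (simp add: Fract_of_int_quotient)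
  then show ?thesis
    using cf_cont_pos[OF assms] cf_cont_coprime[of as]
    by (simp add: quotient_of_Fract normalize_stable del: prod.collapse)
qed

lemma gauss_map_irrational:
  assumes "x \<notin> \<rat>" 
  shows "gauss_map x \<notin> \<rat>" "0 < gauss_map x" "gauss_map x < 1"
proof -
  have x: "x \<noteq> 0" using assms by auto
  have i: "1 / x \<notin> \<rat>" using assms Rats_inverse[of "1 / x"] by auto
  have g: "gauss_map x = 1 / x - of_int \<lfloor>1 / x\<rfloor>" using x by (simp add: gauss_map_def)
  show r: "gauss_map x \<notin> \<rat>"
  proof
    assume "gauss_map x \<in> \<rat>"
    then have "gauss_map x + of_int \<lfloor>1 / x\<rfloor> \<in> \<rat>" by (intro Rats_add Rats_of_int)
    then show False using g i by simp
  qed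
  have "gauss_map x \<noteq> 0" using r by auto
  then show "0 < gauss_map x" "gauss_map x < 1" unfolding g by linarith+
qed

lemma gauss_orbit_irrational:
  assumes "x \<in> {0..<1}" "x \<notin> \<rat>"
  shows "(gauss_map ^^ n) x \<notin> \<rat> \<and> 0 < (gauss_map ^^ n) x \<and> (gauss_map ^^ n) x < 1"
proof (induction n)
  case 0
  have "x \<noteq> 0" using assms by auto
  then show ?case using assms by auto
next
  case (Suc n)
  then show ?case using gauss_map_irrational by simp
qed

lemma cf_digit_ge_1:
  assumes "x \<in> {0..<1}" "x \<notin> \<rat>"
  shows "cf_digit n x \<ge> 1"
  using gauss_orbit_irrational[OF assms, of "n - 1"] by (auto simp: cf_digit_def)

lemma cf_denom_0: "cf_denom 0 x = 1"
  by (simp add: cf_denom_def cf_convergent_def)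

lemma cf_denom_1:
  assumes "x \<in> {0..<1}" "x \<notin> \<rat>"
  shows "cf_denom 1 x = cf_digit 1 x"
  using cf_denom_cont[of "[cf_digit 1 x]"] cf_digit_ge_1[OF assms]
  by (simp add: cf_denom_def cf_convergent_def)

lemma cf_denom_rec:
  assumes "x \<in> {0..<1}" "x \<notin> \<rat>"
  shows "cf_denom (Suc (Suc n)) x = cf_digit (Suc (Suc n)) x * cf_denom (Suc n) x + cf_denom n x"
proof -
  have "cf_denom m x = snd (cf_cont (map (\<lambda>k. cf_digit k x) [1..<Suc m]))" for m
    unfolding cf_denom_def cf_convergent_def
    by (rule cf_denom_cont) (use cf_digit_ge_1[OF assms] in auto)
  then show ?thesis
    using cf_cont_append[of "map (\<lambda>k. cf_digit k x) [1..<Suc n]"] by simp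
qed

text \<open>The deviation sets are Borel, so their measure is not the default value 0 of
  \<open>measure\<close> on non-measurable sets.\<close>

lemma gauss_map_measurable [measurable]: "gauss_map \<in> borel_measurable borel"
  unfolding gauss_map_def by measurable

lemma gauss_iter_measurable [measurable]: "(gauss_map ^^ n) \<in> borel_measurable borel"
proof (induction n)
  case (Suc n)
  then show ?case using measurable_comp[OF Suc gauss_map_measurable] by simp
qed (simp add: id_def)

lemma cf_digit_measurable [measurable]: "cf_digit n \<in> borel \<rightarrow>\<^sub>M count_space UNIV"
proof -
  have "(\<lambda>x. \<lfloor>1 / (gauss_map ^^ (n - 1)) x\<rfloor>) \<in> borel \<rightarrow>\<^sub>M count_space UNIV"
    by measurable
  then show ?thesis by (simp add: cf_digit_def [abs_def])
qed

lemma cf_value_measurable: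
  "(\<lambda>x. cf_value (map (\<lambda>k. cf_digit k x) ks)) \<in> borel \<rightarrow>\<^sub>M count_space UNIV"
proof (induction ks)
  case (Cons k ks)
  note Cons [measurable]
  have "(\<lambda>x. 1 / (of_int (cf_digit k x) + cf_value (map (\<lambda>k. cf_digit k x) ks)))
      \<in> borel \<rightarrow>\<^sub>M count_space UNIV"
    by (rule measurable_compose_countable[where g = "cf_digit k"
          and f = "\<lambda>i x. 1 / (of_int i + cf_value (map (\<lambda>k. cf_digit k x) ks))"])
       (auto intro!: measurable_compose[OF Cons])
  then show ?case by simp
qed simp

lemma cf_denom_measurable [measurable]: "cf_denom n \<in> borel \<rightarrow>\<^sub>M count_space UNIV"
proof -
  have "(\<lambda>x. snd (quotient_of (cf_value (map (\<lambda>k. cf_digit k x) [1..<Suc n]))))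
      \<in> borel \<rightarrow>\<^sub>M count_space UNIV"
    by (rule measurable_compose[OF cf_value_measurable]) simp
  then show ?thesis by (simp add: cf_denom_def [abs_def] cf_convergent_def)
qed

lemma deviation_set_borel:
  "{x \<in> {0..<1}. \<bar>ln (of_int (cf_denom n x)) / real n - c\<bar> \<ge> \<epsilon>} \<in> sets borel"
proof -
  have [measurable]: "(\<lambda>x. real_of_int (cf_denom n x)) \<in> borel_measurable borel"
    by (rule measurable_compose[OF cf_denom_measurable]) simp
  show ?thesis by measurable
qed

end

theory Submission
  imports Defs "HOL-Real_Asymp.Real_Asymp"
begin

text \<open>Up to an error of at most \<open>ln 2\<close>, \<open>ln q\<^sub>n(x)\<close> is the Birkhoff sum of \<open>- ln\<close> along the
  Gauss orbit of \<open>x\<close>, because \<open>q\<^sub>n + q\<^sub>n\<^sub>-\<^sub>1 T\<^sup>n x\<close> is the product of the \<open>1 / T\<^sup>i x\<close> for \<open>i < n\<close>.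
  The transfer operator \<open>P\<close> of the Gauss map with respect to the Gauss measure maps increasing
  functions to decreasing ones, so Lipschitz bounds relative to an increasing function \<open>\<phi>\<close>
  pass to bounds relative to \<open>P \<phi>\<close>; for \<open>\<phi>(t) = t / (1 + 2t)\<close> this is a contraction by 1/2. Hence
  \<open>P\<^sup>n (- ln)\<close> converges uniformly to its mean \<open>L = \<pi>\<^sup>2 / (12 ln 2)\<close>. Adding the bounded coboundary
  of \<open>u = \<Sum>\<^sub>j (P\<^sup>j (- ln) - L)\<close>, \<open>1 \<le> j \<le> N\<close>, to \<open>- ln - L\<close> gives a function \<open>m\<close> with \<open>P m\<close> uniformly
  small, so that \<open>P (exp (\<theta> m)) \<le> exp (\<bar>\<theta>\<bar> \<delta> + C \<theta>\<^sup>2)\<close>; iterating this bounds the exponential moments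
  of the Birkhoff sums, and Markov's inequality gives the upper bound. For the lower bound it is
  enough that the first digit alone exceeds \<open>exp ((L + \<epsilon>) n)\<close>.\<close>

section \<open>The transfer operator\<close>

text \<open>The inverse branch of the Gauss map with first digit \<open>k + 1\<close>.\<close>

definition branch :: "nat \<Rightarrow> real \<Rightarrow> real" where
  "branch k x = 1 / (real k + 1 + x)"

text \<open>The Jacobian of the branch relative to the Gauss density: with
  \<open>s = k + 1 + x\<close> and \<open>\<rho> t\<close> proportional to
  \<open>1 / (1 + t)\<close>, this is
  \<open>\<rho> (1 / s) / (\<rho> x * s\<^sup>2)\<close>.\<close>

definition weight :: "nat \<Rightarrow> real \<Rightarrow> real" where
  "weight k x = (1 + x) / ((real k + 1 + x) * (real k + 2 + x))"

definition transfer :: "(real \<Rightarrow> real) \<Rightarrow> real \<Rightarrow> real" where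
  "transfer h x = (\<Sum>k. weight k x * h (branch k x))"

lemma branch_in: "x \<in> {0<..<1} \<Longrightarrow> branch k x \<in> {0<..<1}"
  by (auto simp: branch_def field_simps)

lemma gauss_map_branch:
  assumes "x \<in> {0<..<1}"
  shows "gauss_map (branch k x) = x"
proof -
  have "\<lfloor>real k + 1 + x\<rfloor> = int k + 1"
    using assms by (simp add: floor_eq_iff)
  then show ?thesis
    using assms by (simp add: gauss_map_def branch_def)
qed

lemma weight_nonneg: "x \<in> {0<..<1} \<Longrightarrow> weight k x \<ge> 0"
  by (simp add: weight_def)

text \<open>All explicit series over the branches telescope in the variable
  \<open>s = k + 1 + x\<close>; only the first value of \<open>R\<close> survives, since
  \<open>R\<close> vanishes at infinity.\<close>

lemma shifted_telescope_sums:
  fixes R :: "real \<Rightarrow> real"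
  assumes "\<And>k. a k = c * (R (real k + 1 + x) - R (real k + 2 + x))"
    and "(R \<longlongrightarrow> 0) at_top"
  shows "a sums (c * R (1 + x))"
proof -
  have "filterlim (\<lambda>k. real k + (1 + x)) at_top sequentially"
    by (rule filterlim_tendsto_add_at_top[OF tendsto_const filterlim_real_sequentially,
          of "1 + x", simplified add.commute])
  then have "(\<lambda>k. R (real k + (1 + x))) \<longlonglongrightarrow> 0"
    using assms(2) by (rule filterlim_compose[rotated])
  then have "(\<lambda>k. R (real k + (1 + x)) - R (real (Suc k) + (1 + x))) sums (R (real 0 + (1 + x)) - 0)"
    by (rule telescope_sums')
  then have "(\<lambda>k. R (real k + 1 + x) - R (real k + 2 + x)) sums R (1 + x)"
    by (simp add: algebra_simps)
  then show ?thesis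
    unfolding assms(1)[abs_def] by (rule sums_mult)
qed

lemma weight_sums:
  assumes "x \<in> {0<..<1}"
  shows "(\<lambda>k. weight k x) sums 1"
proof -
  have "((\<lambda>s::real. 1 / s) \<longlongrightarrow> 0) at_top"
    by real_asymp
  then have "(\<lambda>k. weight k x) sums ((1 + x) * (1 / (1 + x)))"
    using assms by (intro shifted_telescope_sums) (auto simp: weight_def field_simps)
  then show ?thesis using assms by simp
qed

lemma transfer_sums:
  assumes x: "x \<in> {0<..<1}" and B: "\<And>t. t \<in> {0<..<1} \<Longrightarrow> \<bar>h t\<bar> \<le> B"
  shows "(\<lambda>k. weight k x * h (branch k x)) sums transfer h x"
proof -
  have "summable (\<lambda>k. weight k x * B)"
    using weight_sums[OF x] by (intro summable_mult2) (rule sums_summable)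
  then have "summable (\<lambda>k. weight k x * h (branch k x))"
  proof (rule summable_comparison_test')
    fix k show "norm (weight k x * h (branch k x)) \<le> weight k x * B"
      using B[OF branch_in[OF x]] weight_nonneg[OF x]
      by (simp add: abs_mult mult_left_mono)
  qed
  then show ?thesis unfolding transfer_def by (rule summable_sums)
qed

lemma transfer_bounds:
  assumes x: "x \<in> {0<..<1}" and "\<And>t. t \<in> {0<..<1} \<Longrightarrow> a \<le> h t \<and> h t \<le> b"
  shows "a \<le> transfer h x \<and> transfer h x \<le> b"
proof -
  have h: "(\<lambda>k. weight k x * h (branch k x)) sums transfer h x"
    by (rule transfer_sums[OF x, of _ "\<bar>a\<bar> + \<bar>b\<bar>"]) (use assms(2) in fastforce)
  have c: "(\<lambda>k. weight k x * c) sums c" for c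
    using sums_mult2[OF weight_sums[OF x], of c] by simp
  show ?thesis
    using assms(2)[OF branch_in[OF x]] weight_nonneg[OF x]
    by (auto intro!: sums_le[OF _ c h] sums_le[OF _ h c] mult_left_mono)
qed

lemma transfer_measurable:
  assumes [measurable]: "h \<in> borel_measurable borel"
  shows "transfer h \<in> borel_measurable borel"
  unfolding transfer_def[abs_def] weight_def branch_def by measurable

text \<open>Two effects agree. Moving from \<open>x\<close> to \<open>y\<close> lowers every branch
  point, and it shifts weight towards large \<open>k\<close>, where the branch points are smaller.
  The second effect is handled by Abel summation over tail weights.\<close>

lemma transfer_antimono:
  assumes x: "x \<in> {0<..<1}" and y: "y \<in> {0<..<1}" and "x \<le> y"
    and B: "\<And>t. t \<in> {0<..<1} \<Longrightarrow> 0 \<le> h t \<and> h t \<le> B"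
    and mono: "\<And>s t. s \<in> {0<..<1} \<Longrightarrow> t \<in> {0<..<1} \<Longrightarrow> s \<le> t \<Longrightarrow> h s \<le> h t"
  shows "transfer h y \<le> transfer h x"
proof -
  define c where "c k = h (branch k y)" for k
  have sy: "(\<lambda>k. weight k y * c k) sums transfer h y"
    unfolding c_def by (rule transfer_sums[OF y, of _ B]) (use B in auto)
  have sx: "(\<lambda>k. weight k x * h (branch k x)) sums transfer h x"
    by (rule transfer_sums[OF x, of _ B]) (use B in auto)
  \<comment> \<open>\<open>(1 + x) / (k + 1 + x)\<close> is the sum of \<open>weight j x\<close>
    over \<open>j \<ge> k\<close>, so \<open>D k\<close> is the growth of this tail from
    \<open>x\<close> to \<open>y\<close>.\<close>
  define D where "D k = (1 + y) / (real k + 1 + y) - (1 + x) / (real k + 1 + x)" for k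
  have D: "D k \<ge> 0" for k
  proof -
    have "D k = real k * (y - x) / ((real k + 1 + y) * (real k + 1 + x))"
      using x y by (simp add: D_def divide_simps) (simp add: algebra_simps)
    then show ?thesis using x y \<open>x \<le> y\<close> by simp
  qed
  have DS: "weight k x - weight k y = D (Suc k) - D k" for k
    using x y by (simp add: D_def weight_def divide_simps) (simp add: algebra_simps)
  have c0: "c k \<ge> 0" for k
    using B[OF branch_in[OF y]] by (simp add: c_def)
  have cdec: "c (Suc k) \<le> c k" for k
    unfolding c_def using branch_in[OF y] y
    by (intro mono) (auto simp: branch_def field_simps)
  \<comment> \<open>Summation by parts as an inequality: increments of \<open>D\<close> meet the
    decreasing \<open>c\<close>, and the boundary term \<open>D (Suc n) * c n\<close> is
    nonnegative.\<close>
  have "(\<Sum>k<Suc n. (weight k x - weight k y) * c k) \<ge> D (Suc n) * c n" for n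
  proof (induction n)
    case 0
    have "D 0 = 0" using x y by (simp add: D_def)
    then show ?case unfolding DS by simp
  next
    case (Suc n)
    have "D (Suc n) * c (Suc n) \<le> D (Suc n) * c n"
      using D cdec by (intro mult_left_mono)
    then have "D (Suc (Suc n)) * c (Suc n)
        \<le> D (Suc n) * c n + (D (Suc (Suc n)) - D (Suc n)) * c (Suc n)"
      by (simp add: algebra_simps)
    also have "\<dots> \<le> (\<Sum>k<Suc n. (weight k x - weight k y) * c k)
        + (weight (Suc n) x - weight (Suc n) y) * c (Suc n)"
      unfolding DS[of "Suc n"] using Suc.IH by simp
    finally show ?case by simp
  qed
  moreover have "D (Suc n) * c n \<ge> 0" for n using D c0 by simp
  ultimately have "(\<Sum>k<Suc n. (weight k x - weight k y) * c k) \<ge> 0" for n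
    using order_trans by blast
  then have part: "(\<Sum>k<Suc n. weight k y * c k) \<le> (\<Sum>k<Suc n. weight k x * h (branch k x))" for n
  proof -
    have "weight k x * c k \<le> weight k x * h (branch k x)" for k
      unfolding c_def using branch_in x y \<open>x \<le> y\<close>
      by (intro mult_left_mono mono weight_nonneg) (auto simp: branch_def field_simps)
    then have "(\<Sum>k<Suc n. weight k x * c k) \<le> (\<Sum>k<Suc n. weight k x * h (branch k x))"
      by (rule sum_mono)
    moreover have "(\<Sum>k<Suc n. weight k y * c k) \<le> (\<Sum>k<Suc n. weight k x * c k)"
      using \<open>(\<Sum>k<Suc n. (weight k x - weight k y) * c k) \<ge> 0\<close>
      by (simp add: left_diff_distrib sum_subtractf)
    ultimately show ?thesis by linarith
  qed
  have "(\<lambda>n. \<Sum>k<Suc n. weight k y * c k) \<longlonglongrightarrow> transfer h y"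
       "(\<lambda>n. \<Sum>k<Suc n. weight k x * h (branch k x)) \<longlonglongrightarrow> transfer h x"
    using sx[unfolded sums_def, THEN LIMSEQ_Suc] sy[unfolded sums_def, THEN LIMSEQ_Suc]
    by simp_all
  then show ?thesis by (rule LIMSEQ_le) (use part in auto)
qed

section \<open>Contraction of Lipschitz constants under the transfer operator\<close>

text \<open>Lipschitz continuity is measured against this function because its transfer is explicit:
  \<open>1 / (2 (2 + x))\<close>.\<close>

definition ref_scale :: "real \<Rightarrow> real" where
  "ref_scale t = t / (1 + 2 * t)"

lemma ref_scale_diff:
  assumes "x \<in> {0<..<1}" "y \<in> {0<..<1}"
  shows "ref_scale y - ref_scale x = (y - x) / ((1 + 2 * x) * (1 + 2 * y))"
  using assms by (simp add: ref_scale_def divide_simps) (simp add: algebra_simps)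

lemma ref_scale_bounds: "t \<in> {0<..<1} \<Longrightarrow> 0 \<le> ref_scale t \<and> ref_scale t \<le> 1"
  by (simp add: ref_scale_def)

lemma diff_le_ref_scale:
  assumes "x \<in> {0<..<1}" "y \<in> {0<..<1}" "x \<le> y"
  shows "y - x \<le> 9 * (ref_scale y - ref_scale x)"
proof -
  have "(1 + 2 * x) * (1 + 2 * y) \<le> 3 * 3"
    using assms by (intro mult_mono) auto
  then have "(y - x) / 9 \<le> ref_scale y - ref_scale x"
    unfolding ref_scale_diff[OF assms(1,2)] using assms by (intro divide_left_mono) auto
  then show ?thesis by (simp add: pos_divide_le_eq mult.commute)
qed

lemma transfer_ref_scale:
  assumes "x \<in> {0<..<1}"
  shows "transfer ref_scale x = 1 / (2 * (2 + x))"
proof -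
  \<comment> \<open>Since \<open>ref_scale (1 / s) = 1 / (s + 2)\<close>, the term is
    \<open>(1 + x) / (s * (s + 1) * (s + 2))\<close>, which splits into a telescoping
    difference.\<close>
  have eq: "weight k x * ref_scale (branch k x) =
      (1 + x) * (1 / (2 * (real k + 1 + x) * (real k + 1 + x + 1))
        - 1 / (2 * (real k + 2 + x) * (real k + 2 + x + 1)))" for k
  proof -
    define s where "s = real k + 1 + x"
    have "s > 0" using assms by (simp add: s_def)
    then have "1 / (s * (s + 1)) * ((1 / s) / (1 + 2 * (1 / s)))
        = 1 / (2 * s * (s + 1)) - 1 / (2 * (s + 1) * (s + 1 + 1))"
      by (simp add: divide_simps add_pos_pos) (simp add: algebra_simps)
    moreover have "real k + 2 + x = s + 1" by (simp add: s_def)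
    ultimately show ?thesis
      unfolding weight_def ref_scale_def branch_def s_def[symmetric]
      by (metis (no_types, lifting) times_divide_eq_left mult.assoc mult.right_neutral times_divide_eq_right)
  qed
  have "((\<lambda>s::real. 1 / (2 * s * (s + 1))) \<longlongrightarrow> 0) at_top"
    by real_asymp
  then have "(\<lambda>k. weight k x * ref_scale (branch k x)) sums ((1 + x) * (1 / (2 * (1 + x) * (1 + x + 1))))"
    (is "_ sums ?s")
    using assms
    by (intro shifted_telescope_sums) (simp_all add: eq)
  moreover have "?s = 1 / (2 * (2 + x))"
    using assms by (simp add: divide_simps) (simp add: algebra_simps)
  ultimately show ?thesis unfolding transfer_def by (simp add: sums_iff)
qed

text \<open>Equivalently, \<open>C * ref_scale + h\<close> and \<open>C * ref_scale - h\<close> are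
  both increasing on the unit interval, the form in which the monotonicity of the transfer
  applies.\<close>

definition ref_lipschitz :: "real \<Rightarrow> (real \<Rightarrow> real) \<Rightarrow> bool" where
  "ref_lipschitz C h \<longleftrightarrow> (\<forall>x\<in>{0<..<1}. \<forall>y\<in>{0<..<1}. x \<le> y \<longrightarrow>
     \<bar>h x - h y\<bar> \<le> C * (ref_scale y - ref_scale x))"

text \<open>The transfers of \<open>C * ref_scale + h\<close> and \<open>C * ref_scale - h\<close>
  are decreasing, so the increments of \<open>transfer h\<close> are dominated by those of
  \<open>C * transfer ref_scale\<close>, whose explicit formula yields the factor 1/2.\<close>

lemma ref_lipschitz_transfer:
  assumes lip: "ref_lipschitz C h" and B: "\<And>t. t \<in> {0<..<1} \<Longrightarrow> \<bar>h t\<bar> \<le> B" and "C \<ge> 0"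
  shows "ref_lipschitz (C / 2) (transfer h)"
  unfolding ref_lipschitz_def
proof (intro ballI impI)
  fix x y :: real assume x: "x \<in> {0<..<1}" and y: "y \<in> {0<..<1}" and xy: "x \<le> y"
  have B0: "B \<ge> 0" using B[OF x] by linarith
  have *: "C * (transfer ref_scale x - transfer ref_scale y) + \<sigma> * (transfer h x - transfer h y) \<ge> 0"
    if "\<sigma> = 1 \<or> \<sigma> = -1" for \<sigma>
  proof -
    \<comment> \<open>Both signs \<open>\<sigma>\<close> are treated at once; adding
      \<open>B\<close> makes \<open>g\<close> nonnegative, as \<open>transfer_antimono\<close>
      demands.\<close>
    define g where "g t = C * ref_scale t + \<sigma> * h t + B" for t
    have lin: "transfer g z = C * transfer ref_scale z + \<sigma> * transfer h z + B" if z: "z \<in> {0<..<1}" for z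
    proof -
      have "(\<lambda>k. weight k z * ref_scale (branch k z)) sums transfer ref_scale z"
        by (rule transfer_sums[OF z, of _ 1]) (use ref_scale_bounds in auto)
      from sums_add[OF sums_add[OF sums_mult[OF this, where c = C]
            sums_mult[OF transfer_sums[where h = h, OF z B], where c = \<sigma>]]
          sums_mult[OF weight_sums[OF z], where c = B]]
      show ?thesis
        unfolding transfer_def[of g] g_def by (simp add: sums_iff algebra_simps)
    qed
    have "transfer g y \<le> transfer g x"
    proof (rule transfer_antimono[OF x y xy, of _ "C + 2 * B"])
      fix t :: real assume t: "t \<in> {0<..<1}"
      have "0 \<le> C * ref_scale t" "C * ref_scale t \<le> C"
        using ref_scale_bounds[OF t] \<open>C \<ge> 0\<close> by (auto simp: mult_left_le)
      then show "0 \<le> g t \<and> g t \<le> C + 2 * B"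
        using B[OF t] that unfolding g_def by auto
    next
      fix s t :: real assume "s \<in> {0<..<1}" "t \<in> {0<..<1}" "s \<le> t"
      then have "\<bar>h s - h t\<bar> \<le> C * (ref_scale t - ref_scale s)"
        using lip unfolding ref_lipschitz_def by blast
      then show "g s \<le> g t"
        using that unfolding g_def by (auto simp: algebra_simps)
    qed
    then show ?thesis
      using lin[OF x] lin[OF y] by (simp add: algebra_simps)
  qed
  have "transfer ref_scale x - transfer ref_scale y = (y - x) / (2 * ((2 + x) * (2 + y)))"
    using x y by (simp add: transfer_ref_scale divide_simps) (simp add: algebra_simps)
  \<comment> \<open>On the unit interval \<open>1 + 2 * x \<le> 2 + x\<close>; the leftover factor 2
    in the denominator is the contraction.\<close>
  also have "\<dots> \<le> (y - x) / (2 * ((1 + 2 * x) * (1 + 2 * y)))"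
    using x y xy by (intro divide_left_mono mult_left_mono mult_mono) auto
  also have "\<dots> = (ref_scale y - ref_scale x) / 2"
    using x y by (simp add: ref_scale_diff)
  finally have "C * (transfer ref_scale x - transfer ref_scale y) \<le> C * ((ref_scale y - ref_scale x) / 2)"
    using \<open>C \<ge> 0\<close> by (rule mult_left_mono)
  then show "\<bar>transfer h x - transfer h y\<bar> \<le> C / 2 * (ref_scale y - ref_scale x)"
    using *[of 1] *[of "-1"] unfolding abs_le_iff by (simp add: algebra_simps)
qed

section \<open>The Gauss measure\<close>

definition gauss_measure :: "real measure" where
  "gauss_measure = density lborel (\<lambda>x. ennreal (indicator {0<..<1} x / (ln 2 * (1 + x))))"

lemma sets_gauss_measure [measurable_cong, simp]: "sets gauss_measure = sets borel"
  by (simp add: gauss_measure_def)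

lemma nn_integral_gauss_measure:
  assumes [measurable]: "h \<in> borel_measurable borel"
  shows "(\<integral>\<^sup>+x. ennreal (h x) \<partial>gauss_measure) =
    (\<integral>\<^sup>+x. ennreal (h x / (ln 2 * (1 + x))) * indicator {0<..<1} x \<partial>lborel)"
  unfolding gauss_measure_def
  by (subst nn_integral_density)
    (auto intro!: nn_integral_cong simp: indicator_def ennreal_mult''[symmetric] mult.commute)

lemma AE_gauss_measure: "AE x in gauss_measure. x \<in> {0<..<1}"
  unfolding gauss_measure_def by (subst AE_density) (auto simp: indicator_def)

section \<open>Change of variables along the inverse branches\<close>

lemma AE_indicator_Ioo_Icc:
  "AE x in lborel. (indicator {a<..<b} x :: ennreal) = indicator {a..b} (x :: real)"
  using AE_lborel_singleton[of a] AE_lborel_singleton[of b]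
  by eventually_elim (auto simp: indicator_def)

lemma AE_indicator_Ioc_Icc:
  "AE x in lborel. (indicator {a<..b} x :: ennreal) = indicator {a..b} (x :: real)"
  using AE_lborel_singleton[of a] by eventually_elim (auto simp: indicator_def)

lemma nn_integral_branch:
  fixes h :: "real \<Rightarrow> real"
  assumes [measurable]: "h \<in> borel_measurable borel"
  shows "(\<integral>\<^sup>+x. ennreal (h x) * indicator {1 / (real k + 2)<..1 / (real k + 1)} x \<partial>lborel) =
    (\<integral>\<^sup>+x. ennreal (h (branch k x) / (real k + 1 + x)\<^sup>2) * indicator {0<..<1} x \<partial>lborel)"
proof -
  \<comment> \<open>\<open>g y = branch k (1 - y)\<close>: the reflection turns the decreasing
    branch into an increasing substitution and is undone afterwards by an affine change of
    variables.\<close>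
  define g where "g y = 1 / (real k + 2 - y)" for y
  define g' where "g' y = 1 / (real k + 2 - y)\<^sup>2" for y
  have [measurable]: "g \<in> borel_measurable borel" "g' \<in> borel_measurable borel"
    unfolding g_def[abs_def] g'_def[abs_def] by measurable
  have "(\<integral>\<^sup>+x. ennreal (h x) * indicator {1 / (real k + 2)<..1 / (real k + 1)} x \<partial>lborel)
      = (\<integral>\<^sup>+x. ennreal (h x) * indicator {g 0..g 1} x \<partial>lborel)"
    using AE_indicator_Ioc_Icc[of "1 / (real k + 2)" "1 / (real k + 1)"]
    by (intro nn_integral_cong_AE, eventually_elim) (simp add: g_def add.commute)
  also have "\<dots> = (\<integral>\<^sup>+x. ennreal (h x * indicator {g 0..g 1} x) \<partial>lborel)"
    by (intro nn_integral_cong) (simp add: indicator_def)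
  also have "\<dots> = (\<integral>\<^sup>+y. ennreal (h (g y) * g' y * indicator {0..1} y) \<partial>lborel)"
  proof (rule nn_integral_substitution)
    show "set_borel_measurable borel {g 0..g 1} h"
      unfolding set_borel_measurable_def by measurable
    show "(g has_real_derivative g' y) (at y)" if "y \<in> {0..1}" for y
      unfolding g_def g'_def using that
      by (auto intro!: derivative_eq_intros simp: power2_eq_square divide_simps)
    show "continuous_on {0..1} g'"
      unfolding g'_def by (intro continuous_intros) auto
  qed (auto simp: g'_def)
  also have "\<dots> = (\<integral>\<^sup>+x. ennreal (h (g (1 - x)) * g' (1 - x) * indicator {0..1} (1 - x)) \<partial>lborel)"
    by (subst nn_integral_real_affine[where c = "-1" and t = 1]) simp_all
  also have "\<dots> = (\<integral>\<^sup>+x. ennreal (h (branch k x) / (real k + 1 + x)\<^sup>2) * indicator {0<..<1} x \<partial>lborel)"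
    using AE_indicator_Ioo_Icc[of 0 1]
    by (intro nn_integral_cong_AE, eventually_elim)
      (auto simp: g_def g'_def branch_def indicator_def algebra_simps split: if_splits)
  finally show ?thesis .
qed

text \<open>For positive \<open>x\<close> these intervals are the level sets of
  \<open>\<lfloor>1 / x\<rfloor>\<close>, that is, of the first digit \<open>k + 1\<close>.\<close>

lemma Ioc_branch_cover:
  "disjoint_family (\<lambda>k. {1 / (real k + 2)<..1 / (real k + 1)})"
  "(\<Union>k. {1 / (real k + 2)<..1 / (real k + 1)}) = {0<..1}"
proof -
  have eq: "x \<in> {1 / (real k + 2)<..1 / (real k + 1)} \<longleftrightarrow> x > 0 \<and> \<lfloor>1 / x\<rfloor> = int k + 1" for x k
  proof -
    have "x > 0" if "1 / (real k + 2) < x"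
      by (rule less_trans[OF _ that]) simp
    then show ?thesis by (auto simp: floor_eq_iff field_simps)
  qed
  show "disjoint_family (\<lambda>k. {1 / (real k + 2)<..1 / (real k + 1)})"
    unfolding disjoint_family_on_def using eq by fastforce
  show "(\<Union>k. {1 / (real k + 2)<..1 / (real k + 1)}) = {0<..1}"
  proof (intro set_eqI iffI)
    fix x :: real assume "x \<in> {0<..1}"
    then have "1 / x \<ge> 1" "x > 0" by auto
    then have "x \<in> {1 / (real (nat (\<lfloor>1 / x\<rfloor> - 1)) + 2)<..1 / (real (nat (\<lfloor>1 / x\<rfloor> - 1)) + 1)}"
      unfolding eq by (simp add: le_floor_iff)
    then show "x \<in> (\<Union>k. {1 / (real k + 2)<..1 / (real k + 1)})" by blast
  next
    fix x :: real assume "x \<in> (\<Union>k. {1 / (real k + 2)<..1 / (real k + 1)})"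
    then obtain k where k: "x \<in> {1 / (real k + 2)<..1 / (real k + 1)}" by blast
    then have "x > 0" using eq by blast
    moreover have "1 / (real k + 1) \<le> 1" by simp
    moreover have "x \<le> 1 / (real k + 1)" using k by simp
    ultimately show "x \<in> {0<..1}" by (auto intro: order_trans)
  qed
qed

text \<open>Invariance of the Gauss measure in dual form. The integral is split by the first digit
  and each piece is pulled back along its branch, where the weight absorbs density and Jacobian. The
  series is taken in \<open>ennreal\<close> so that unbounded \<open>h\<close> is covered.\<close>

lemma nn_integral_transfer:
  fixes h :: "real \<Rightarrow> real"
  assumes h[measurable]: "h \<in> borel_measurable borel"
  shows "(\<integral>\<^sup>+x. ennreal (h x) \<partial>gauss_measure) =
    (\<integral>\<^sup>+x. (\<Sum>k. ennreal (weight k x * h (branch k x))) \<partial>gauss_measure)"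
proof -
  have [measurable]: "branch k \<in> borel_measurable borel" "weight k \<in> borel_measurable borel" for k
    unfolding branch_def[abs_def] weight_def[abs_def] by measurable
  define H where "H x = h x / (ln 2 * (1 + x))" for x
  have [measurable]: "H \<in> borel_measurable borel" unfolding H_def[abs_def] by measurable
  have "(\<integral>\<^sup>+x. ennreal (h x) \<partial>gauss_measure) = (\<integral>\<^sup>+x. ennreal (H x) * indicator {0<..1} x \<partial>lborel)"
    unfolding nn_integral_gauss_measure[OF h] H_def
    using AE_indicator_Ioo_Icc[of 0 1] AE_indicator_Ioc_Icc[of 0 1]
    by (intro nn_integral_cong_AE, eventually_elim) simp
  also have "\<dots> = (\<Sum>k. \<integral>\<^sup>+x. ennreal (H x) * indicator {1 / (real k + 2)<..1 / (real k + 1)} x \<partial>lborel)"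
    using nn_integral_disjoint_family[of "\<lambda>x. ennreal (H x)" lborel
        "\<lambda>k. {1 / (real k + 2)<..1 / (real k + 1)}"] Ioc_branch_cover
    by simp
  also have "\<dots> = (\<Sum>k. \<integral>\<^sup>+x. ennreal (weight k x * h (branch k x)) \<partial>gauss_measure)"
  proof (intro suminf_cong)
    fix k
    have "H (branch k x) / (real k + 1 + x)\<^sup>2 = weight k x * h (branch k x) / (ln 2 * (1 + x))"
      if x: "x \<in> {0<..<1}" for x
    proof -
      have s: "real k + 1 + x > 0" "real k + 2 + x > 0" "1 + x > 0" using x by auto
      have "1 + branch k x = (real k + 2 + x) / (real k + 1 + x)"
        using s by (simp add: branch_def field_simps)
      then show ?thesis
        using s unfolding H_def weight_def by (simp add: divide_simps power2_eq_square)
    qed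
    then have "(\<integral>\<^sup>+x. ennreal (H (branch k x) / (real k + 1 + x)\<^sup>2) * indicator {0<..<1} x \<partial>lborel)
        = (\<integral>\<^sup>+x. ennreal (weight k x * h (branch k x)) \<partial>gauss_measure)"
      by (subst nn_integral_gauss_measure) (auto intro!: nn_integral_cong simp: indicator_def)
    then show "(\<integral>\<^sup>+x. ennreal (H x) * indicator {1 / (real k + 2)<..1 / (real k + 1)} x \<partial>lborel)
        = (\<integral>\<^sup>+x. ennreal (weight k x * h (branch k x)) \<partial>gauss_measure)"
      by (simp add: nn_integral_branch)
  qed
  also have "\<dots> = (\<integral>\<^sup>+x. (\<Sum>k. ennreal (weight k x * h (branch k x))) \<partial>gauss_measure)"
    by (rule nn_integral_suminf[symmetric]) measurable
  finally show ?thesis .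
qed

lemma emeasure_gauss_measure_space: "emeasure gauss_measure (space gauss_measure) = 1"
proof -
  have "emeasure gauss_measure (space gauss_measure) = (\<integral>\<^sup>+x. ennreal 1 \<partial>gauss_measure)"
    by simp
  also have "\<dots> = (\<integral>\<^sup>+x. ennreal (1 / (ln 2 * (1 + x))) * indicator {0..1} x \<partial>lborel)"
    unfolding nn_integral_gauss_measure[OF borel_measurable_const]
    using AE_indicator_Ioo_Icc[of 0 1]
    by (intro nn_integral_cong_AE, eventually_elim) simp
  also have "\<dots> = ennreal (ln (1 + 1) / ln 2 - ln (1 + 0) / ln 2)"
    by (rule nn_integral_FTC_Icc) (auto intro!: derivative_eq_intros simp: divide_simps)
  finally show ?thesis by simp
qed

text \<open>Induction by peeling off the first factor: after one transfer the other factors depend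
  only on \<open>gauss_map (branch k x) = x\<close>, so they leave the series, and what remains in
  it is at most \<open>c\<close>.\<close>

lemma nn_integral_gauss_iterate_le:
  fixes h :: "real \<Rightarrow> real"
  assumes h[measurable]: "h \<in> borel_measurable borel"
    and nonneg: "\<And>x. h x \<ge> 0" and "c \<ge> 0"
    and le: "\<And>x. x \<in> {0<..<1} \<Longrightarrow> (\<Sum>k. ennreal (weight k x * h (branch k x))) \<le> ennreal c"
  shows "(\<integral>\<^sup>+x. ennreal (\<Prod>i<n. h ((gauss_map ^^ i) x)) \<partial>gauss_measure) \<le> ennreal (c ^ n)"
proof (induction n)
  case 0
  show ?case by (simp add: emeasure_gauss_measure_space)
next
  case (Suc n)
  define p where "p x = (\<Prod>i<n. h ((gauss_map ^^ i) x))" for x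
  have p[measurable]: "p \<in> borel_measurable borel"
    unfolding p_def[abs_def] by measurable
  have p0: "p x \<ge> 0" for x unfolding p_def by (intro prod_nonneg) (auto simp: nonneg)
  have "(\<Prod>i<Suc n. h ((gauss_map ^^ i) x)) = h x * p (gauss_map x)" for x
    unfolding prod.lessThan_Suc_shift p_def by (simp add: funpow_swap1)
  then have "(\<integral>\<^sup>+x. ennreal (\<Prod>i<Suc n. h ((gauss_map ^^ i) x)) \<partial>gauss_measure)
      = (\<integral>\<^sup>+x. ennreal (h x * p (gauss_map x)) \<partial>gauss_measure)" by simp
  also have "\<dots> = (\<integral>\<^sup>+x. (\<Sum>k. ennreal (weight k x * (h (branch k x) * p (gauss_map (branch k x)))))
      \<partial>gauss_measure)"
    by (rule nn_integral_transfer) measurable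
  also have "\<dots> \<le> (\<integral>\<^sup>+x. ennreal c * ennreal (p x) \<partial>gauss_measure)"
  proof (rule nn_integral_mono_AE)
    show "AE x in gauss_measure. (\<Sum>k. ennreal (weight k x * (h (branch k x) * p (gauss_map (branch k x)))))
        \<le> ennreal c * ennreal (p x)"
      using AE_gauss_measure
    proof eventually_elim
      case (elim x)
      have "(\<Sum>k. ennreal (weight k x * (h (branch k x) * p (gauss_map (branch k x)))))
          = (\<Sum>k. ennreal (weight k x * h (branch k x)) * ennreal (p x))"
        using elim weight_nonneg[OF elim] nonneg p0
        by (intro suminf_cong) (simp add: gauss_map_branch ennreal_mult mult.assoc)
      also have "\<dots> = (\<Sum>k. ennreal (weight k x * h (branch k x))) * ennreal (p x)"
        by (rule ennreal_suminf_multc)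
      also have "\<dots> \<le> ennreal c * ennreal (p x)"
        using le[OF elim] by (rule mult_right_mono) simp
      finally show ?case .
    qed
  qed
  also have "\<dots> = ennreal c * (\<integral>\<^sup>+x. ennreal (p x) \<partial>gauss_measure)"
    by (rule nn_integral_cmult) measurable
  also have "\<dots> \<le> ennreal c * ennreal (c ^ n)"
    using Suc.IH unfolding p_def by (rule mult_left_mono) simp
  also have "\<dots> = ennreal (c ^ Suc n)"
    using \<open>c \<ge> 0\<close> by (simp add: ennreal_mult)
  finally show ?case .
qed

section \<open>The mean of the logarithm\<close>

lemma continuous_on_mult_ln: "continuous_on {0..1} (\<lambda>x::real. x * ln x)"
  unfolding continuous_on_eq_continuous_within
proof (intro ballI)
  fix x :: real assume x: "x \<in> {0..1}"
  show "continuous (at x within {0..1}) (\<lambda>x. x * ln x)"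
  proof (cases "x = 0")
    case True
    have "((\<lambda>x::real. x * ln x) \<longlongrightarrow> 0) (at_right 0)" by real_asymp
    then show ?thesis
      by (simp add: True continuous_within at_within_Icc_at_right)
  next
    case False
    then show ?thesis by (intro continuous_intros) auto
  qed
qed

lemma has_integral_ln_power:
  "((\<lambda>x::real. - ln x * x ^ n) has_integral (1 / (real n + 1)\<^sup>2)) {0..1}"
proof -
  \<comment> \<open>The antiderivative from integration by parts, arranged so that \<open>ln\<close>
    occurs only in \<open>x * ln x\<close>; this gives continuity at 0 even for
    \<open>n = 0\<close>.\<close>
  define F where "F x = x ^ (n + 1) / (real n + 1)\<^sup>2 - x ^ n * (x * ln x) / (real n + 1)" for x :: real
  have "((\<lambda>x. - ln x * x ^ n) has_integral (F 1 - F 0)) {0..1}"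
  proof (rule fundamental_theorem_of_calculus_interior)
    show "continuous_on {0..1} F"
      unfolding F_def by (intro continuous_intros continuous_on_mult_ln) auto
    fix x :: real assume x: "x \<in> {0<..<1}"
    define c where "c = real n + 1"
    have c: "c > 0" by (simp add: c_def)
    have p: "((\<lambda>x. x ^ Suc n) has_real_derivative c * x ^ n) (at x)"
      using DERIV_pow[of "Suc n" x] by (simp add: c_def add.commute)
    have l: "(ln has_real_derivative 1 / x) (at x)"
      using x by (intro DERIV_ln_divide) auto
    have "((\<lambda>x. x ^ Suc n / c\<^sup>2 - x ^ Suc n * ln x / c) has_real_derivative
        c * x ^ n / c\<^sup>2 - (c * x ^ n * ln x + 1 / x * x ^ Suc n) / c) (at x)"
      by (rule DERIV_diff[OF DERIV_cdivide[OF p] DERIV_cdivide[OF DERIV_mult[OF p l]]])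
    also have "c * x ^ n / c\<^sup>2 - (c * x ^ n * ln x + 1 / x * x ^ Suc n) / c = - ln x * x ^ n"
    proof -
      have "1 / x * x ^ Suc n = x ^ n" using x by simp
      then show ?thesis using c by (simp add: field_simps power2_eq_square)
    qed
    also have "(\<lambda>x. x ^ Suc n / c\<^sup>2 - x ^ Suc n * ln x / c) = F"
      by (simp add: F_def c_def fun_eq_iff mult_ac)
    finally show "(F has_vector_derivative - ln x * x ^ n) (at x)"
      by (simp add: has_real_derivative_iff_has_vector_derivative)
  qed simp
  then show ?thesis by (simp add: F_def)
qed

text \<open>The full sum \<open>pi\<^sup>2 / 6\<close> minus twice the part with even bases, which
  is a quarter of it.\<close>

lemma alternating_inverse_squares_sums:
  "(\<lambda>j. 1 / (2 * real j + 1)\<^sup>2 - 1 / (2 * real j + 2)\<^sup>2) sums (pi\<^sup>2 / 12)"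
proof -
  have s: "(\<lambda>n. 1 / (real n + 1)\<^sup>2) sums (pi\<^sup>2 / 6)"
    using inverse_squares_sums by (simp add: add.commute)
  have "(\<lambda>n. sum (\<lambda>n. 1 / (real n + 1)\<^sup>2) {n * 2..<n * 2 + 2}) sums (pi\<^sup>2 / 6)"
    by (rule sums_group[OF s]) simp
  then have g: "(\<lambda>j. 1 / (2 * real j + 1)\<^sup>2 + 1 / (2 * real j + 2)\<^sup>2) sums (pi\<^sup>2 / 6)"
    by (simp add: numeral_2_eq_2 algebra_simps)
  have "(\<lambda>j. 1 / 2 * (1 / (real j + 1)\<^sup>2)) sums (1 / 2 * (pi\<^sup>2 / 6))"
    by (rule sums_mult[OF s])
  also have "(\<lambda>j. 1 / 2 * (1 / (real j + 1)\<^sup>2)) = (\<lambda>j. 2 * (1 / (2 * real j + 2)\<^sup>2))"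
    by (rule ext) (simp add: divide_simps power2_eq_square, simp add: algebra_simps)
  finally have "(\<lambda>j. 2 * (1 / (2 * real j + 2)\<^sup>2)) sums (1 / 2 * (pi\<^sup>2 / 6))" .
  from sums_diff[OF g this] show ?thesis by simp
qed

text \<open>The factor \<open>1 / (1 + x)\<close> of the Gauss density is expanded geometrically,
  with consecutive terms paired as \<open>x ^ (2 * j) - x ^ (2 * j + 1)\<close>. The pairs are
  nonnegative, so the series may be integrated termwise in \<open>ennreal\<close>, which leaves the
  alternating sum of inverse squares.\<close>

lemma nn_integral_neg_ln:
  "(\<integral>\<^sup>+x. ennreal (- ln x) \<partial>gauss_measure) = ennreal (pi\<^sup>2 / (12 * ln 2))"
proof -
  define t where "t j x = - ln x * (x ^ (2 * j) - x ^ (2 * j + 1)) / ln 2" for j and x :: real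
  have t[measurable]: "t j \<in> borel_measurable borel" for j
    unfolding t_def[abs_def] by measurable
  have t0: "t j x \<ge> 0" if "x \<in> {0..1}" for j x
  proof -
    have "x ^ (2 * j + 1) \<le> x ^ (2 * j)" using that by (intro power_decreasing) auto
    moreover have "- ln x \<ge> 0" using that by (cases "x = 0") auto
    ultimately show ?thesis unfolding t_def by (intro divide_nonneg_nonneg mult_nonneg_nonneg) auto
  qed
  have ti: "(\<integral>\<^sup>+x. ennreal (t j x) * indicator {0<..<1} x \<partial>lborel)
      = ennreal ((1 / (2 * real j + 1)\<^sup>2 - 1 / (2 * real j + 2)\<^sup>2) / ln 2)" for j
  proof -
    have "((\<lambda>x. (- ln x * x ^ (2 * j) - (- ln x * x ^ (2 * j + 1))) / ln 2) has_integral
        ((1 / (real (2 * j) + 1)\<^sup>2 - 1 / (real (2 * j + 1) + 1)\<^sup>2) / ln 2)) {0..1}"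
      by (intro has_integral_divide has_integral_diff has_integral_ln_power)
    moreover have "(\<lambda>x. (- ln x * x ^ (2 * j) - (- ln x * x ^ (2 * j + 1))) / ln 2) = t j"
      by (rule ext) (simp add: t_def right_diff_distrib)
    ultimately have "(t j has_integral ((1 / (2 * real j + 1)\<^sup>2 - 1 / (2 * real j + 2)\<^sup>2) / ln 2)) {0..1}"
      by (simp add: add.commute)
    from nn_integral_has_integral_lebesgue[OF t0 this]
    have "(\<integral>\<^sup>+x. ennreal (indicator {0..1} x * t j x) \<partial>lborel)
      = ennreal ((1 / (2 * real j + 1)\<^sup>2 - 1 / (2 * real j + 2)\<^sup>2) / ln 2)" by blast
    moreover have "(\<integral>\<^sup>+x. ennreal (t j x) * indicator {0<..<1} x \<partial>lborel)
        = (\<integral>\<^sup>+x. ennreal (indicator {0..1} x * t j x) \<partial>lborel)"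
      using AE_indicator_Ioo_Icc[of 0 1]
      by (intro nn_integral_cong_AE, eventually_elim) (auto simp: indicator_def)
    ultimately show ?thesis by simp
  qed
  have "(\<integral>\<^sup>+x. ennreal (- ln x) \<partial>gauss_measure)
      = (\<integral>\<^sup>+x. ennreal (- ln x / (ln 2 * (1 + x))) * indicator {0<..<1} x \<partial>lborel)"
    by (rule nn_integral_gauss_measure) measurable
  also have "\<dots> = (\<integral>\<^sup>+x. (\<Sum>j. ennreal (t j x) * indicator {0<..<1} x) \<partial>lborel)"
  proof (intro nn_integral_cong)
    fix x :: real
    show "ennreal (- ln x / (ln 2 * (1 + x))) * indicator {0<..<1} x
        = (\<Sum>j. ennreal (t j x) * indicator {0<..<1} x)"
    proof (cases "x \<in> {0<..<1}")
      case True
      then have "x\<^sup>2 < 1" by (simp add: power_less_one_iff)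
      then have "(\<lambda>j. (x\<^sup>2) ^ j) sums (1 / (1 - x\<^sup>2))"
        by (intro geometric_sums) simp
      then have "(\<lambda>j. - ln x * (1 - x) / ln 2 * (x\<^sup>2) ^ j) sums (- ln x * (1 - x) / ln 2 * (1 / (1 - x\<^sup>2)))"
        by (rule sums_mult)
      moreover have "- ln x * (1 - x) / ln 2 * (1 / (1 - x\<^sup>2)) = - ln x / (ln 2 * (1 + x))"
      proof -
        have "1 - x\<^sup>2 = (1 - x) * (1 + x)" by (simp add: power2_eq_square algebra_simps)
        then show ?thesis using True by (simp add: divide_simps)
      qed
      moreover have "(\<lambda>j. - ln x * (1 - x) / ln 2 * (x\<^sup>2) ^ j) = (\<lambda>j. t j x)"
      proof
        fix j
        define p where "p = (x\<^sup>2) ^ j"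
        have "x ^ (2 * j) = p" by (simp only: p_def power_mult)
        then show "- ln x * (1 - x) / ln 2 * (x\<^sup>2) ^ j = t j x"
          unfolding t_def power_add p_def[symmetric] by (simp add: algebra_simps)
      qed
      ultimately have "(\<lambda>j. t j x) sums (- ln x / (ln 2 * (1 + x)))" by simp
      then have "(\<Sum>j. ennreal (t j x)) = ennreal (- ln x / (ln 2 * (1 + x)))"
        by (rule suminf_ennreal_eq[rotated]) (use t0 True in simp)
      moreover have "indicator {0<..<1} x = (1 :: ennreal)" using True by simp
      ultimately show ?thesis by (simp only: mult_1_right)
    qed simp
  qed
  also have "\<dots> = (\<Sum>j. \<integral>\<^sup>+x. ennreal (t j x) * indicator {0<..<1} x \<partial>lborel)"
    by (rule nn_integral_suminf) measurable
  also have "\<dots> = (\<Sum>j. ennreal ((1 / (2 * real j + 1)\<^sup>2 - 1 / (2 * real j + 2)\<^sup>2) / ln 2))"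
    by (simp add: ti)
  also have "\<dots> = ennreal (pi\<^sup>2 / 12 / ln 2)"
  proof (intro suminf_ennreal_eq sums_divide alternating_inverse_squares_sums)
    fix j
    have "1 / (2 * real j + 2)\<^sup>2 \<le> 1 / (2 * real j + 1)\<^sup>2"
      by (intro divide_left_mono power_mono mult_pos_pos zero_less_power) auto
    then show "0 \<le> (1 / (2 * real j + 1)\<^sup>2 - 1 / (2 * real j + 2)\<^sup>2) / ln 2" by simp
  qed
  finally show ?thesis by simp
qed

text \<open>Although \<open>- ln\<close> is unbounded, it differs from \<open>ln (1 + t) / t\<close> by a function whose
  transfer telescopes to \<open>ln (1 + x)\<close>.\<close>

lemma neg_ln_transfer_sums:
  assumes x: "x \<in> {0<..<1}"
  shows "(\<lambda>k. weight k x * - ln (branch k x)) sums (ln (1 + x) + transfer (\<lambda>t. ln (1 + t) / t) x)"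
proof -
  define h :: "real \<Rightarrow> real" where "h t = ln (1 + t) / t" for t
  have hb: "\<bar>h t\<bar> \<le> 1" if "t \<in> {0<..<1}" for t
    using that ln_add_one_self_le_self[of t] by (auto simp: h_def divide_simps)
  have "((\<lambda>s::real. ln s / s) \<longlongrightarrow> 0) at_top" by real_asymp
  then have "(\<lambda>k. weight k x * (- ln (branch k x) - h (branch k x))) sums ((1 + x) * (ln (1 + x) / (1 + x)))"
  proof (rule shifted_telescope_sums[rotated])
    fix k
    define s where "s = real k + 1 + x"
    have s: "s > 0" using x by (simp add: s_def)
    have s1: "real k + 2 + x = s + 1" by (simp add: s_def)
    \<comment> \<open>Thus \<open>h (1 / s) = s * (ln (s + 1) - ln s)\<close>, and division by
      \<open>s * (s + 1)\<close> leaves a difference of consecutive values of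
      \<open>ln s / s\<close>.\<close>
    have "ln (1 + 1 / s) = ln (s + 1) - ln s"
      using s ln_div[of "s + 1" s] by (simp add: add_divide_distrib)
    then have "weight k x * (- ln (branch k x) - h (branch k x))
        = (1 + x) / (s * (s + 1)) * (ln s - s * (ln (s + 1) - ln s))"
      using s unfolding weight_def branch_def h_def s1 s_def[symmetric]
      by (simp add: ln_div mult.commute)
    also have "\<dots> = (1 + x) * (ln s / s - ln (s + 1) / (s + 1))"
      using s by (simp add: divide_simps) (simp add: algebra_simps)
    finally show "weight k x * (- ln (branch k x) - h (branch k x))
        = (1 + x) * (ln (real k + 1 + x) / (real k + 1 + x) - ln (real k + 2 + x) / (real k + 2 + x))"
      unfolding s1 s_def[symmetric] .
  qed
  from sums_add[OF this transfer_sums[where h = h, OF x hb]]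
  have "(\<lambda>k. weight k x * - ln (branch k x)) sums ((1 + x) * (ln (1 + x) / (1 + x)) + transfer h x)"
    by (simp add: algebra_simps)
  moreover have "(1 + x) * (ln (1 + x) / (1 + x)) = ln (1 + x)" using x by simp
  ultimately show ?thesis unfolding h_def by simp
qed

text \<open>The derivative is at most 1 in absolute value, because
  \<open>t / (1 + t) \<le> ln (1 + t) \<le> t\<close>; the 9 converts ordinary distance into
  \<open>ref_scale\<close> distance.\<close>

lemma ref_lipschitz_ln_add_one_over:
  "ref_lipschitz 9 (\<lambda>t. ln (1 + t) / t)"
  unfolding ref_lipschitz_def
proof (intro ballI impI)
  fix x y :: real assume x: "x \<in> {0<..<1}" and y: "y \<in> {0<..<1}" and "x \<le> y"
  have "\<bar>ln (1 + x) / x - ln (1 + y) / y\<bar> \<le> 1 * \<bar>x - y\<bar>"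
  proof (rule field_differentiable_bound[where S = "{0<..<1}" and 'a = real,
        where f' = "\<lambda>t. (t / (1 + t) - ln (1 + t)) / t\<^sup>2", unfolded real_norm_def])
    fix t :: real assume t: "t \<in> {0<..<1}"
    show "((\<lambda>t. ln (1 + t) / t) has_field_derivative (t / (1 + t) - ln (1 + t)) / t\<^sup>2) (at t within {0<..<1})"
      using t by (auto intro!: derivative_eq_intros simp: power2_eq_square divide_simps)
    have "ln (1 + t) \<le> t" using t by (intro ln_add_one_self_le_self) auto
    moreover have "ln (1 + t) \<ge> t / (1 + t)"
      using t ln_le_minus_one[of "1 / (1 + t)"]
      by (simp add: ln_div field_simps)
    moreover have "t - t / (1 + t) \<le> t\<^sup>2"
      using t by (simp add: divide_simps power2_eq_square) (simp add: algebra_simps)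
    ultimately have "\<bar>t / (1 + t) - ln (1 + t)\<bar> \<le> t\<^sup>2" by linarith
    then show "\<bar>(t / (1 + t) - ln (1 + t)) / t\<^sup>2\<bar> \<le> 1"
      using t by (simp add: abs_divide)
  qed (use x y in auto)
  then show "\<bar>ln (1 + x) / x - ln (1 + y) / y\<bar> \<le> 9 * (ref_scale y - ref_scale x)"
    using diff_le_ref_scale[OF x y \<open>x \<le> y\<close>] \<open>x \<le> y\<close> by argo
qed

text \<open>The transfer of \<open>- ln\<close> is \<open>ln (1 + x)\<close> plus the transfer of
  \<open>ln (1 + t) / t\<close>. Both summands lie between 0 and 1; their Lipschitz constants are 9
  and, after one contraction, 9/2.\<close>

lemma transfer_neg_ln:
  shows "x \<in> {0<..<1} \<Longrightarrow> (\<lambda>k. weight k x * - ln (branch k x)) sums transfer (\<lambda>t. - ln t) x"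
    and "x \<in> {0<..<1} \<Longrightarrow> 0 \<le> transfer (\<lambda>t. - ln t) x \<and> transfer (\<lambda>t. - ln t) x \<le> 2"
    and "ref_lipschitz (27 / 2) (transfer (\<lambda>t. - ln t))"
proof -
  define h :: "real \<Rightarrow> real" where "h t = ln (1 + t) / t" for t
  have hb: "0 \<le> h t \<and> h t \<le> 1" if "t \<in> {0<..<1}" for t
    using that ln_add_one_self_le_self[of t] by (auto simp: h_def divide_simps)
  have s: "(\<lambda>k. weight k x * - ln (branch k x)) sums (ln (1 + x) + transfer h x)"
    if "x \<in> {0<..<1}" for x
    using neg_ln_transfer_sums[OF that] unfolding h_def .
  then have eq: "transfer (\<lambda>t. - ln t) x = ln (1 + x) + transfer h x" if "x \<in> {0<..<1}" for x
    using that unfolding transfer_def[of "\<lambda>t. - ln t"] by (simp add: sums_iff)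
  show "(\<lambda>k. weight k x * - ln (branch k x)) sums transfer (\<lambda>t. - ln t) x" if "x \<in> {0<..<1}"
    using s[OF that] eq[OF that] by simp
  show "0 \<le> transfer (\<lambda>t. - ln t) x \<and> transfer (\<lambda>t. - ln t) x \<le> 2" if x: "x \<in> {0<..<1}"
    using transfer_bounds[of x 0 h 1, OF x hb] eq[OF x] x ln_add_one_self_le_self[of x]
    by auto
  have "ref_lipschitz (9 / 2) (transfer h)"
    using ref_lipschitz_ln_add_one_over hb unfolding h_def
    by (intro ref_lipschitz_transfer[where B = 1]) fastforce+
  show "ref_lipschitz (27 / 2) (transfer (\<lambda>t. - ln t))"
    unfolding ref_lipschitz_def
  proof (intro ballI impI)
    fix x y :: real assume x: "x \<in> {0<..<1}" and y: "y \<in> {0<..<1}" and xy: "x \<le> y"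
    have "ln (1 + y) - ln (1 + x) \<le> y - x"
    proof -
      have "ln ((1 + y) / (1 + x)) \<le> (1 + y) / (1 + x) - 1"
        using x y by (intro ln_le_minus_one) auto
      also have "\<dots> = (y - x) / (1 + x)" using x by (simp add: field_simps)
      also have "\<dots> \<le> y - x" using x xy by (intro divide_le_eq[THEN iffD2]) (auto simp: mult_le_cancel_left1)
      finally show ?thesis using x y by (simp add: ln_div)
    qed
    moreover have "ln (1 + x) \<le> ln (1 + y)" using x xy by simp
    moreover have "\<bar>transfer h x - transfer h y\<bar> \<le> 9 / 2 * (ref_scale y - ref_scale x)"
      using \<open>ref_lipschitz (9 / 2) (transfer h)\<close> x y xy unfolding ref_lipschitz_def by blast
    ultimately show "\<bar>transfer (\<lambda>t. - ln t) x - transfer (\<lambda>t. - ln t) y\<bar>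
        \<le> 27 / 2 * (ref_scale y - ref_scale x)"
      unfolding eq[OF x] eq[OF y] using diff_le_ref_scale[OF x y xy] by argo
  qed
qed

section \<open>Iterated transfers of the logarithm\<close>

abbreviation log_transfer :: "nat \<Rightarrow> real \<Rightarrow> real" where
  "log_transfer n \<equiv> (transfer ^^ n) (\<lambda>t. - ln t)"

lemma log_transfer_measurable [measurable]: "log_transfer n \<in> borel_measurable borel"
  by (induction n) (auto intro: transfer_measurable)

text \<open>At index 0 the function is the unbounded \<open>- ln\<close>. One transfer makes it
  bounded and Lipschitz; each further one halves the Lipschitz constant and keeps the range.\<close>

lemma log_transfer_Suc:
  "x \<in> {0<..<1} \<Longrightarrow> 0 \<le> log_transfer (Suc n) x \<and> log_transfer (Suc n) x \<le> 2"
  "ref_lipschitz (27 / 2 ^ Suc n) (log_transfer (Suc n))"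
proof -
  have "(\<forall>x\<in>{0<..<1}. 0 \<le> log_transfer (Suc n) x \<and> log_transfer (Suc n) x \<le> 2)
      \<and> ref_lipschitz (27 / 2 ^ Suc n) (log_transfer (Suc n))"
  proof (induction n)
    case 0
    then show ?case using transfer_neg_ln(2,3) by simp
  next
    case (Suc n)
    have "ref_lipschitz (27 / 2 ^ Suc n / 2) (transfer (log_transfer (Suc n)))"
      using Suc by (intro ref_lipschitz_transfer[where B = 2]) force+
    moreover have "0 \<le> transfer (log_transfer (Suc n)) x \<and> transfer (log_transfer (Suc n)) x \<le> 2"
      if "x \<in> {0<..<1}" for x
      using Suc that by (intro transfer_bounds) auto
    ultimately show ?case by (simp del: funpow.simps add: funpow.simps(2)[of "Suc n"] mult.commute)
  qed
  then show "x \<in> {0<..<1} \<Longrightarrow> 0 \<le> log_transfer (Suc n) x \<and> log_transfer (Suc n) x \<le> 2"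
    "ref_lipschitz (27 / 2 ^ Suc n) (log_transfer (Suc n))" by blast+
qed

lemma log_transfer_sums:
  assumes "x \<in> {0<..<1}"
  shows "(\<lambda>k. weight k x * log_transfer n (branch k x)) sums log_transfer (Suc n) x"
proof (cases n)
  case 0
  then show ?thesis using transfer_neg_ln(1)[OF assms] by simp
next
  case (Suc m)
  have "(\<lambda>k. weight k x * log_transfer (Suc m) (branch k x)) sums transfer (log_transfer (Suc m)) x"
    by (rule transfer_sums[OF assms, of _ 2]) (use log_transfer_Suc(1)[of _ m] in force)
  then show ?thesis by (simp add: Suc)
qed

lemma nn_integral_log_transfer:
  "(\<integral>\<^sup>+x. ennreal (log_transfer n x) \<partial>gauss_measure) = ennreal (pi\<^sup>2 / (12 * ln 2))"
proof (induction n)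
  case 0
  then show ?case by (simp add: nn_integral_neg_ln)
next
  case (Suc n)
  have pos: "0 \<le> log_transfer n x" if "x \<in> {0<..<1}" for x
    using log_transfer_Suc(1)[OF that] that by (cases n) auto
  have "(\<integral>\<^sup>+x. ennreal (log_transfer (Suc n) x) \<partial>gauss_measure)
      = (\<integral>\<^sup>+x. (\<Sum>k. ennreal (weight k x * log_transfer n (branch k x))) \<partial>gauss_measure)"
  proof (rule nn_integral_cong_AE)
    show "AE x in gauss_measure. ennreal (log_transfer (Suc n) x)
        = (\<Sum>k. ennreal (weight k x * log_transfer n (branch k x)))"
      using AE_gauss_measure
    proof eventually_elim
      case (elim x)
      have "0 \<le> weight k x * log_transfer n (branch k x)" for k
        using weight_nonneg[OF elim] pos[OF branch_in[OF elim]] by simp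
      from suminf_ennreal_eq[OF this log_transfer_sums[OF elim]] show ?case by (rule sym)
    qed
  qed
  also have "\<dots> = (\<integral>\<^sup>+x. ennreal (log_transfer n x) \<partial>gauss_measure)"
    by (rule nn_integral_transfer[symmetric]) measurable
  finally show ?case using Suc.IH by simp
qed

text \<open>As \<open>ref_scale\<close> takes values between 0 and 1, the Lipschitz constant bounds
  the oscillation, and every value of a function is within its oscillation of the mean. Invariance
  keeps the mean fixed.\<close>

lemma log_transfer_convergence:
  assumes x: "x \<in> {0<..<1}"
  shows "\<bar>log_transfer (Suc n) x - pi\<^sup>2 / (12 * ln 2)\<bar> \<le> 27 / 2 ^ Suc n"
proof -
  define c :: real where "c = 27 / 2 ^ Suc n"
  define G where "G = log_transfer (Suc n)"
  define L :: real where "L = pi\<^sup>2 / (12 * ln 2)"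
  have L: "L \<ge> 0" by (simp add: L_def)
  have c: "c > 0" by (simp add: c_def)
  have G0: "G y \<ge> 0" if "y \<in> {0<..<1}" for y
    using log_transfer_Suc(1)[OF that] unfolding G_def by blast
  have le: "\<bar>G y - G z\<bar> \<le> c" if "y \<in> {0<..<1}" "z \<in> {0<..<1}" "y \<le> z" for y z
  proof -
    have "\<bar>G y - G z\<bar> \<le> c * (ref_scale z - ref_scale y)"
      using log_transfer_Suc(2)[of n] that unfolding ref_lipschitz_def G_def c_def by blast
    also have "\<dots> \<le> c"
      using ref_scale_bounds[OF that(1)] ref_scale_bounds[OF that(2)] c
      by (intro mult_left_le) auto
    finally show ?thesis .
  qed
  have osc: "\<bar>G x - G y\<bar> \<le> c" if "y \<in> {0<..<1}" for y
    using le[OF x that] le[OF that x] by linarith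
  have int: "(\<integral>\<^sup>+y. ennreal (G y) \<partial>gauss_measure) = ennreal L"
    unfolding G_def L_def by (rule nn_integral_log_transfer)
  have const: "(\<integral>\<^sup>+y. ennreal d \<partial>gauss_measure) = ennreal d" for d
    by (simp add: emeasure_gauss_measure_space)
  have "(\<integral>\<^sup>+y. ennreal (G y) \<partial>gauss_measure) \<le> (\<integral>\<^sup>+y. ennreal (G x + c) \<partial>gauss_measure)"
  proof (rule nn_integral_mono_AE)
    show "AE y in gauss_measure. ennreal (G y) \<le> ennreal (G x + c)"
      using AE_gauss_measure
      by eventually_elim (rule ennreal_leI, drule osc, linarith)
  qed
  then have "L \<le> G x + c"
    unfolding int const using G0[OF x] c by (subst (asm) ennreal_le_iff) auto
  moreover have "(\<integral>\<^sup>+y. ennreal (G x - c) \<partial>gauss_measure) \<le> (\<integral>\<^sup>+y. ennreal (G y) \<partial>gauss_measure)"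
  proof (rule nn_integral_mono_AE)
    show "AE y in gauss_measure. ennreal (G x - c) \<le> ennreal (G y)"
      using AE_gauss_measure
      by eventually_elim (rule ennreal_leI, drule osc, linarith)
  qed
  \<comment> \<open>A negative \<open>G x - c\<close> is truncated to 0 by \<open>ennreal\<close>;
    the comparison survives because \<open>L \<ge> 0\<close>.\<close>
  then have "G x - c \<le> L"
    unfolding int const using L by (simp add: ennreal_le_iff)
  ultimately show ?thesis unfolding G_def L_def c_def by linarith
qed

section \<open>Exponential moments\<close>

text \<open>\<open>u\<close> truncates the series solving
  \<open>u - transfer u = transfer (- ln) - L\<close>, so everything telescopes except the remainder
  \<open>r = log_transfer (Suc N) x - L\<close>, which is small for large \<open>N\<close>.\<close>

lemma corrector_exists:
  assumes "\<delta> > 0"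
  obtains u :: "real \<Rightarrow> real" and U where "u \<in> borel_measurable borel"
    and "\<And>x. x \<in> {0<..<1} \<Longrightarrow> \<bar>u x\<bar> \<le> U"
    and "\<And>x. x \<in> {0<..<1} \<Longrightarrow> \<exists>r. \<bar>r\<bar> \<le> \<delta> \<and>
      (\<lambda>k. weight k x * (- ln (branch k x) - pi\<^sup>2 / (12 * ln 2) + u (branch k x) - u x)) sums r"
proof -
  define L :: real where "L = pi\<^sup>2 / (12 * ln 2)"
  obtain N where N: "27 / 2 ^ Suc N \<le> \<delta>"
  proof -
    have "(\<lambda>n. 27 / 2 ^ Suc n :: real) \<longlonglongrightarrow> 0" by real_asymp
    then have "eventually (\<lambda>n. 27 / 2 ^ Suc n < \<delta>) sequentially"
      using assms by (rule order_tendstoD)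
    then obtain n where "27 / 2 ^ Suc n < \<delta>" by (auto simp: eventually_sequentially)
    then show ?thesis by (intro that[of n] less_imp_le)
  qed
  define u where "u x = (\<Sum>j<N. log_transfer (Suc j) x - L)" for x
  show ?thesis
  proof
    show "u \<in> borel_measurable borel"
      unfolding u_def[abs_def]
      by (intro borel_measurable_sum borel_measurable_diff log_transfer_measurable borel_measurable_const)
    show "\<bar>u x\<bar> \<le> real N * 27" if x: "x \<in> {0<..<1}" for x
    proof -
      have "\<bar>log_transfer (Suc j) x - L\<bar> \<le> 27" for j
      proof -
        have "\<bar>log_transfer (Suc j) x - L\<bar> \<le> 27 / 2 ^ Suc j"
          unfolding L_def by (rule log_transfer_convergence[OF x])
        also have "\<dots> \<le> 27 / 1"
          by (intro divide_left_mono one_le_power) auto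
        finally show ?thesis by simp
      qed
      then have "\<bar>u x\<bar> \<le> (\<Sum>j<N. 27)"
        unfolding u_def by (intro order_trans[OF sum_abs] sum_mono)
      then show ?thesis by simp
    qed
    show "\<exists>r. \<bar>r\<bar> \<le> \<delta> \<and>
      (\<lambda>k. weight k x * (- ln (branch k x) - pi\<^sup>2 / (12 * ln 2) + u (branch k x) - u x)) sums r"
      if x: "x \<in> {0<..<1}" for x
    proof (intro exI conjI)
      have c: "(\<lambda>k. weight k x * c) sums c" for c
        using sums_mult2[OF weight_sums[OF x], of c] by simp
      have t: "(\<lambda>k. weight k x * (log_transfer n (branch k x) - L)) sums (log_transfer (Suc n) x - L)" for n
        using sums_diff[OF log_transfer_sums[OF x, of n] c[of L]]
        by (simp only: right_diff_distrib)
      have "(\<lambda>k. weight k x * u (branch k x)) sums (\<Sum>j<N. log_transfer (Suc (Suc j)) x - L)"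
        unfolding u_def sum_distrib_left by (intro sums_sum t)
      from sums_diff[OF sums_add[OF t[of 0] this] c[of "u x"]]
      have s: "(\<lambda>k. weight k x * (- ln (branch k x) - L + u (branch k x) - u x)) sums
          ((log_transfer (Suc 0) x - L) + (\<Sum>j<N. log_transfer (Suc (Suc j)) x - L) - u x)"
        by (simp add: algebra_simps)
      have "(log_transfer (Suc 0) x - L) + (\<Sum>j<N. log_transfer (Suc (Suc j)) x - L)
          - u x = log_transfer (Suc N) x - L"
        unfolding u_def sum.lessThan_Suc_shift[of "\<lambda>j. log_transfer (Suc j) x - L" N, symmetric]
        using sum.lessThan_Suc[of "\<lambda>j. log_transfer (Suc j) x - L" N] by simp
      with s show "(\<lambda>k. weight k x * (- ln (branch k x) - pi\<^sup>2 / (12 * ln 2) + u (branch k x) - u x))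
          sums (log_transfer (Suc N) x - L)"
        unfolding L_def by (simp only:)
      show "\<bar>log_transfer (Suc N) x - L\<bar> \<le> \<delta>"
        using log_transfer_convergence[OF x, of N] N unfolding L_def by linarith
    qed
  qed
qed

section \<open>Exponential estimates for a single transfer step\<close>

lemma exp_le_quadratic:
  fixes y :: real
  shows "exp y \<le> 1 + y + y\<^sup>2 / 2 * exp \<bar>y\<bar>"
proof -
  obtain t where t: "\<bar>t\<bar> \<le> \<bar>y\<bar>" "exp y = (\<Sum>m<2. y ^ m / fact m) + exp t / fact 2 * y ^ 2"
    using Maclaurin_exp_le[of y 2] by auto
  have "exp t * y\<^sup>2 \<le> exp \<bar>y\<bar> * y\<^sup>2"
    using t(1) by (intro mult_right_mono) auto
  then show ?thesis using t(2) by (simp add: numeral_2_eq_2 algebra_simps)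
qed

text \<open>The square in the Taylor remainder is absorbed by raising the exponent from
  \<open>\<bar>m\<bar> / 4\<close> to \<open>\<bar>m\<bar> / 2\<close>. For \<open>m\<close> of the
  size of \<open>ln s\<close> the error then grows like \<open>sqrt s\<close>, which is still
  summable against the weights.\<close>

lemma exp_small_multiple_le:
  fixes m \<theta> :: real
  assumes "\<bar>\<theta>\<bar> \<le> 1 / 4"
  shows "exp (\<theta> * m) \<le> 1 + \<theta> * m + 16 * \<theta>\<^sup>2 * exp (\<bar>m\<bar> / 2)"
proof -
  define z where "z = \<bar>m\<bar> / 4"
  have z: "z \<ge> 0" by (simp add: z_def)
  have "z\<^sup>2 / 2 \<le> exp z"
    using exp_lower_Taylor_quadratic[OF z] z by linarith
  then have "m\<^sup>2 \<le> 32 * exp z" by (simp add: z_def power_divide)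
  moreover have "exp \<bar>\<theta> * m\<bar> \<le> exp z"
    using mult_right_mono[OF assms, of "\<bar>m\<bar>"] by (simp add: z_def abs_mult)
  ultimately have "m\<^sup>2 * exp \<bar>\<theta> * m\<bar> \<le> 32 * exp z * exp z"
    by (intro mult_mono) auto
  also have "\<dots> = 32 * exp (\<bar>m\<bar> / 2)" by (simp add: z_def flip: exp_add)
  finally have "\<theta>\<^sup>2 / 2 * (m\<^sup>2 * exp \<bar>\<theta> * m\<bar>) \<le> \<theta>\<^sup>2 / 2 * (32 * exp (\<bar>m\<bar> / 2))"
    by (rule mult_left_mono) simp
  then show ?thesis
    using exp_le_quadratic[of "\<theta> * m"] by (simp add: power_mult_distrib algebra_simps)
qed

text \<open>A telescoping majorant: for the two roots \<open>a \<le> b\<close>, the identity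
  \<open>b * b - a * a = 1\<close> gives \<open>1 / a - 1 / b = 1 / (a * b * (b + a)) \<ge> 1 / (2 *
  a * b * b)\<close>.\<close>

lemma weight_mult_sqrt_le:
  assumes "x \<in> {0<..<1}"
  shows "weight k x * sqrt (real k + 1 + x) \<le>
    2 * (1 + x) * (1 / sqrt (real k + 1 + x) - 1 / sqrt (real k + 2 + x))"
proof -
  define a where "a = sqrt (real k + 1 + x)"
  define b where "b = sqrt (real k + 2 + x)"
  have ab: "0 < a" "a \<le> b" using assms by (auto simp: a_def b_def)
  then have b: "0 < b" by linarith
  have a2: "real k + 1 + x = a * a" and b2: "real k + 2 + x = b * b"
    using assms by (auto simp: a_def b_def)
  have "(b - a) * (b + a) = 1" using a2 b2 by (simp add: algebra_simps)
  then have "b - a = 1 / (b + a)" using ab b by (simp add: field_simps)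
  moreover have "1 / a - 1 / b = (b - a) / (a * b)"
    using ab b by (simp add: field_simps)
  ultimately have "1 / a - 1 / b = 1 / (a * b * (b + a))"
    by (simp add: mult.commute)
  moreover have "1 / (a * b * (b + b)) \<le> 1 / (a * b * (b + a))"
    using ab b by (intro divide_left_mono mult_left_mono mult_pos_pos) auto
  moreover have "2 * (1 / (a * b * (b + b))) = 1 / (a * (b * b))"
    using ab b by (simp add: divide_simps)
  ultimately have "1 / (a * (b * b)) \<le> 2 * (1 / a - 1 / b)" by argo
  then have "(1 + x) * (1 / (a * (b * b))) \<le> (1 + x) * (2 * (1 / a - 1 / b))"
    using assms by (intro mult_left_mono) auto
  moreover have "weight k x * a = (1 + x) * (1 / (a * (b * b)))"
    unfolding weight_def a2 b2 using ab b by (simp add: divide_simps)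
  ultimately show ?thesis
    unfolding a_def[symmetric] b_def[symmetric] by (simp only: mult.assoc mult.left_commute[of "1 + x" 2])
qed

text \<open>Summed against the weights, the quadratic bound for the exponential yields 1 from the
  total weight, \<open>\<theta> * r\<close> from the linear term and a multiple of
  \<open>\<theta>\<^sup>2\<close> from the error; then \<open>1 + y \<le> exp y\<close>.\<close>

lemma transfer_exp_le:
  fixes m :: "real \<Rightarrow> real"
  assumes x: "x \<in> {0<..<1}" and "\<bar>r\<bar> \<le> \<delta>" and r: "(\<lambda>k. weight k x * m (branch k x)) sums r"
    and K: "\<And>k. \<bar>m (branch k x)\<bar> \<le> ln (real k + 1 + x) + K"
    and \<theta>: "\<bar>\<theta>\<bar> \<le> 1 / 4"
  shows "(\<Sum>k. ennreal (weight k x * exp (\<theta> * m (branch k x))))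
    \<le> ennreal (exp (\<bar>\<theta>\<bar> * \<delta> + 64 * exp (K / 2) * \<theta>\<^sup>2))"
proof -
  define C where "C = 16 * \<theta>\<^sup>2 * exp (K / 2)"
  have C: "C \<ge> 0" by (simp add: C_def)
  define d where "d k = 2 * (1 + x) * (1 / sqrt (real k + 1 + x) - 1 / sqrt (real k + 2 + x))" for k
  define b where "b k = weight k x + \<theta> * (weight k x * m (branch k x)) + C * d k" for k
  have le: "weight k x * exp (\<theta> * m (branch k x)) \<le> b k" for k
  proof -
    define s where "s = real k + 1 + x"
    have s: "s > 0" using x by (simp add: s_def)
    define y where "y = m (branch k x)"
    have "exp (\<bar>y\<bar> / 2) \<le> exp (K / 2) * sqrt s"
    proof -
      have "exp (\<bar>y\<bar> / 2) \<le> exp (K / 2 + ln s / 2)"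
        using K[of k] by (simp add: y_def s_def)
      also have "\<dots> = exp (K / 2) * sqrt s"
        using s by (simp add: exp_add powr_half_sqrt[symmetric] powr_def)
      finally show ?thesis .
    qed
    then have "16 * \<theta>\<^sup>2 * exp (\<bar>y\<bar> / 2) \<le> C * sqrt s"
      unfolding C_def mult.assoc by (intro mult_left_mono) auto
    then have "exp (\<theta> * y) \<le> 1 + \<theta> * y + C * sqrt s"
      using exp_small_multiple_le[OF \<theta>, of y] by linarith
    then have "weight k x * exp (\<theta> * y) \<le> weight k x * (1 + \<theta> * y + C * sqrt s)"
      using weight_nonneg[OF x] by (rule mult_left_mono)
    also have "\<dots> = weight k x + \<theta> * (weight k x * y) + C * (weight k x * sqrt s)"
      by (simp add: algebra_simps)
    also have "\<dots> \<le> b k"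
      unfolding b_def y_def d_def s_def using C weight_mult_sqrt_le[OF x, of k]
      by (intro add_left_mono mult_left_mono)
    finally show ?thesis unfolding y_def .
  qed
  define E where "E = 2 * (1 + x) * (1 / sqrt (1 + x))"
  have "d sums E"
    unfolding E_def
  proof (rule shifted_telescope_sums)
    show "((\<lambda>s::real. 1 / sqrt s) \<longlongrightarrow> 0) at_top" by real_asymp
  qed (simp add: d_def)
  from sums_add[OF sums_add[OF weight_sums[OF x] sums_mult[OF r, of \<theta>]] sums_mult[OF this, of C]]
  have bs: "b sums (1 + \<theta> * r + C * E)"
    unfolding b_def .
  \<comment> \<open>The linear part of \<open>b k\<close> may be negative, but \<open>b k\<close>
    dominates a nonnegative term; hence its series can be evaluated in
    \<open>ennreal\<close>.\<close>
  have b0: "b k \<ge> 0" for k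
    using le[of k] weight_nonneg[OF x, of k] by (meson exp_ge_zero mult_nonneg_nonneg order_trans)
  have "(\<Sum>k. ennreal (weight k x * exp (\<theta> * m (branch k x)))) \<le> (\<Sum>k. ennreal (b k))"
    by (intro suminf_le ennreal_leI le summableI)
  also have "\<dots> = ennreal (1 + \<theta> * r + C * E)"
    by (rule suminf_ennreal_eq[OF b0 bs])
  also have "\<dots> \<le> ennreal (exp (\<bar>\<theta>\<bar> * \<delta> + 64 * exp (K / 2) * \<theta>\<^sup>2))"
  proof (rule ennreal_leI)
    \<comment> \<open>\<open>E = 2 * sqrt (1 + x) \<le> 4\<close>, and this 4 times the 16 in
      \<open>C\<close> is the 64.\<close>
    have "E = 2 * ((1 + x) / sqrt (1 + x))" by (simp add: E_def)
    also have "\<dots> = 2 * sqrt (1 + x)" using x by (subst real_div_sqrt) auto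
    also have "\<dots> \<le> 2 * 2" using x by (intro mult_left_mono real_le_lsqrt) auto
    finally have "C * E \<le> C * 4"
      using C by (intro mult_left_mono) auto
    moreover have "\<theta> * r \<le> \<bar>\<theta>\<bar> * \<delta>"
      using mult_left_mono[OF \<open>\<bar>r\<bar> \<le> \<delta>\<close>, of "\<bar>\<theta>\<bar>"] abs_ge_self[of "\<theta> * r"]
      by (simp add: abs_mult)
    moreover have "C * 4 = 64 * exp (K / 2) * \<theta>\<^sup>2" by (simp add: C_def)
    ultimately have "1 + \<theta> * r + C * E
        \<le> 1 + (\<bar>\<theta>\<bar> * \<delta> + 64 * exp (K / 2) * \<theta>\<^sup>2)"
      by linarith
    also have "\<dots> \<le> exp (\<bar>\<theta>\<bar> * \<delta> + 64 * exp (K / 2) * \<theta>\<^sup>2)"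
      by (rule exp_ge_add_one_self)
    finally show "1 + \<theta> * r + C * E
        \<le> exp (\<bar>\<theta>\<bar> * \<delta> + 64 * exp (K / 2) * \<theta>\<^sup>2)" .
  qed
  finally show ?thesis .
qed

text \<open>Adding the coboundary of a bounded \<open>u\<close> changes the Birkhoff sums of \<open>- ln\<close> by a bounded
  amount only, and makes the transfer of the summand uniformly small.\<close>

lemma exponential_moment_bound:
  assumes "\<delta> > 0"
  obtains u :: "real \<Rightarrow> real" and U C where "u \<in> borel_measurable borel" "C > 0"
    and "\<And>x. x \<in> {0<..<1} \<Longrightarrow> \<bar>u x\<bar> \<le> U"
    and "\<And>\<theta> n. \<bar>\<theta>\<bar> \<le> 1 / 4 \<Longrightarrow>
      (\<integral>\<^sup>+x. ennreal (exp (\<theta> * (\<Sum>i<n. - ln ((gauss_map ^^ i) x) - pi\<^sup>2 / (12 * ln 2)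
          + u ((gauss_map ^^ i) x) - u ((gauss_map ^^ Suc i) x)))) \<partial>gauss_measure)
        \<le> ennreal (exp (real n * (\<bar>\<theta>\<bar> * \<delta> + C * \<theta>\<^sup>2)))"
proof -
  define L :: real where "L = pi\<^sup>2 / (12 * ln 2)"
  obtain u U where u[measurable]: "u \<in> borel_measurable borel"
    and U: "\<And>x. x \<in> {0<..<1} \<Longrightarrow> \<bar>u x\<bar> \<le> U"
    and r: "\<And>x. x \<in> {0<..<1} \<Longrightarrow> \<exists>r. \<bar>r\<bar> \<le> \<delta> \<and>
      (\<lambda>k. weight k x * (- ln (branch k x) - L + u (branch k x) - u x)) sums r"
    using corrector_exists[OF assms] unfolding L_def by blast
  \<comment> \<open>Along the branches over \<open>x\<close> the term \<open>u (gauss_map x)\<close>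
    becomes \<open>u x\<close>, which matches the summand controlled by the corrector.\<close>
  define m where "m x = - ln x - L + u x - u (gauss_map x)" for x
  have [measurable]: "m \<in> borel_measurable borel" unfolding m_def[abs_def] by measurable
  define K where "K = \<bar>L\<bar> + 2 * U"
  have step: "(\<Sum>k. ennreal (weight k x * exp (\<theta> * m (branch k x))))
      \<le> ennreal (exp (\<bar>\<theta>\<bar> * \<delta> + 64 * exp (K / 2) * \<theta>\<^sup>2))"
    if x: "x \<in> {0<..<1}" and \<theta>: "\<bar>\<theta>\<bar> \<le> 1 / 4" for x \<theta>
  proof -
    obtain r where "\<bar>r\<bar> \<le> \<delta>"
      "(\<lambda>k. weight k x * (- ln (branch k x) - L + u (branch k x) - u x)) sums r"
      using r[OF x] by blast
    moreover have "\<bar>m (branch k x)\<bar> \<le> ln (real k + 1 + x) + K" for k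
    proof -
      have "- ln (branch k x) = ln (real k + 1 + x)" using x by (simp add: branch_def ln_div)
      moreover have "ln (real k + 1 + x) \<ge> 0" using x by simp
      ultimately show ?thesis
        using U[OF x] U[OF branch_in[OF x], of k]
        unfolding m_def gauss_map_branch[OF x] K_def by linarith
    qed
    ultimately show ?thesis
      using \<theta> by (intro transfer_exp_le[OF x]) (auto simp: m_def gauss_map_branch[OF x])
  qed
  show ?thesis
  proof
    show "u \<in> borel_measurable borel" by (rule u)
    show "64 * exp (K / 2) > 0" by simp
    show "\<bar>u x\<bar> \<le> U" if "x \<in> {0<..<1}" for x using U[OF that] .
    fix \<theta> :: real and n assume \<theta>: "\<bar>\<theta>\<bar> \<le> 1 / 4"
    \<comment> \<open>The exponential of the Birkhoff sum is a product along the orbit, so the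
      one-step bound is iterated.\<close>
    have "(\<integral>\<^sup>+x. ennreal (\<Prod>i<n. exp (\<theta> * m ((gauss_map ^^ i) x))) \<partial>gauss_measure)
        \<le> ennreal (exp (\<bar>\<theta>\<bar> * \<delta> + 64 * exp (K / 2) * \<theta>\<^sup>2) ^ n)"
      using step[OF _ \<theta>] by (intro nn_integral_gauss_iterate_le) auto
    then show "(\<integral>\<^sup>+x. ennreal (exp (\<theta> * (\<Sum>i<n. - ln ((gauss_map ^^ i) x) - pi\<^sup>2 / (12 * ln 2)
          + u ((gauss_map ^^ i) x) - u ((gauss_map ^^ Suc i) x)))) \<partial>gauss_measure)
        \<le> ennreal (exp (real n * (\<bar>\<theta>\<bar> * \<delta> + 64 * exp (K / 2) * \<theta>\<^sup>2)))"
      by (simp add: exp_sum[symmetric] exp_of_nat_mult[symmetric] m_def L_def sum_distrib_left)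
  qed
qed

section \<open>Denominators and deviations\<close>

lemma cf_digit_add_gauss_map:
  assumes "x \<in> {0..<1}" "x \<notin> \<rat>"
  shows "real_of_int (cf_digit (Suc n) x) + (gauss_map ^^ Suc n) x = 1 / (gauss_map ^^ n) x"
  using gauss_orbit_irrational[OF assms, of n] by (simp add: cf_digit_def gauss_map_def)

lemma cf_denom_pos_mono:
  assumes "x \<in> {0..<1}" "x \<notin> \<rat>"
  shows "1 \<le> cf_denom n x \<and> cf_denom n x \<le> cf_denom (Suc n) x"
proof (induction n)
  case 0
  show ?case using cf_digit_ge_1[OF assms, of 1] cf_denom_1[OF assms] by (simp add: cf_denom_0)
next
  case (Suc n)
  have "1 * cf_denom (Suc n) x \<le> cf_digit (Suc (Suc n)) x * cf_denom (Suc n) x"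
    using Suc cf_digit_ge_1[OF assms] by (intro mult_right_mono) auto
  then show ?case using Suc cf_denom_rec[OF assms, of n] by linarith
qed

text \<open>By the recurrence and \<open>cf_digit_add_gauss_map\<close>, raising \<open>n\<close> by
  one multiplies the left-hand side by exactly the next factor of the product.\<close>

lemma cf_denom_prod:
  assumes "x \<in> {0..<1}" "x \<notin> \<rat>"
  shows "real_of_int (cf_denom (Suc n) x) + cf_denom n x * (gauss_map ^^ Suc n) x
    = (\<Prod>i<Suc n. 1 / (gauss_map ^^ i) x)"
proof (induction n)
  case 0
  show ?case
    using cf_digit_add_gauss_map[OF assms, of 0] cf_denom_1[OF assms] by (simp add: cf_denom_0)
next
  case (Suc n)
  define t where "t = (gauss_map ^^ Suc n) x"
  have t: "t > 0" using gauss_orbit_irrational[OF assms, of "Suc n"] by (simp add: t_def)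
  have "real_of_int (cf_denom (Suc (Suc n)) x) + cf_denom (Suc n) x * (gauss_map ^^ Suc (Suc n)) x
      = (real_of_int (cf_digit (Suc (Suc n)) x) + (gauss_map ^^ Suc (Suc n)) x) * cf_denom (Suc n) x
        + cf_denom n x"
    unfolding cf_denom_rec[OF assms] by (simp add: algebra_simps)
  also have "\<dots> = (real_of_int (cf_denom (Suc n) x) + cf_denom n x * t) * (1 / t)"
    unfolding cf_digit_add_gauss_map[OF assms] t_def[symmetric] using t by (simp add: field_simps)
  also have "\<dots> = (\<Prod>i<Suc (Suc n). 1 / (gauss_map ^^ i) x)"
    unfolding prod.lessThan_Suc[of _ "Suc n"] t_def Suc.IH ..
  finally show ?case .
qed

text \<open>The product \<open>p\<close> exceeds \<open>q\<close> by the previous denominator times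
  an orbit point below 1, hence by at most \<open>q\<close>; so
  \<open>q \<le> p \<le> 2 * q\<close>.\<close>

lemma ln_cf_denom_approx:
  assumes x: "x \<in> {0..<1}" "x \<notin> \<rat>" and "n \<ge> 1"
  shows "\<bar>ln (real_of_int (cf_denom n x)) - (\<Sum>i<n. - ln ((gauss_map ^^ i) x))\<bar> \<le> ln 2"
proof -
  obtain m where n: "n = Suc m" using \<open>n \<ge> 1\<close> by (cases n) auto
  define q :: real where "q = of_int (cf_denom n x)"
  define p :: real where "p = (\<Prod>i<n. 1 / (gauss_map ^^ i) x)"
  have orbit: "0 < (gauss_map ^^ i) x" "(gauss_map ^^ i) x < 1" for i
    using gauss_orbit_irrational[OF x] by auto
  have q: "q \<ge> 1" using cf_denom_pos_mono[OF x, of n] by (simp add: q_def)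
  have le: "0 \<le> real_of_int (cf_denom m x)" "real_of_int (cf_denom m x) \<le> q"
    using cf_denom_pos_mono[OF x, of m] by (auto simp: q_def n)
  have "real_of_int (cf_denom m x) * (gauss_map ^^ n) x \<le> q * 1"
    using orbit[of n] le by (intro mult_mono) auto
  moreover have "0 \<le> real_of_int (cf_denom m x) * (gauss_map ^^ n) x"
    using orbit[of n] le by simp
  moreover have "q + cf_denom m x * (gauss_map ^^ n) x = p"
    unfolding q_def p_def n by (rule cf_denom_prod[OF x])
  ultimately have "q \<le> p" "p \<le> 2 * q" by linarith+
  then have "ln q \<le> ln p" "ln p \<le> ln (2 * q)" using q by auto
  moreover have "ln (2 * q) = ln 2 + ln q" using q by (simp add: ln_mult)
  moreover have "ln p = (\<Sum>i<n. - ln ((gauss_map ^^ i) x))"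
  proof -
    have "ln p = (\<Sum>i<n. ln (1 / (gauss_map ^^ i) x))"
      unfolding p_def using orbit by (intro ln_prod) (auto simp: less_imp_neq[symmetric])
    also have "\<dots> = (\<Sum>i<n. - ln ((gauss_map ^^ i) x))"
      using orbit by (intro sum.cong) (auto simp: ln_div less_imp_neq[symmetric])
    finally show ?thesis .
  qed
  ultimately show ?thesis unfolding q_def by linarith
qed

lemma cf_denom_ge_digit_1:
  assumes "x \<in> {0..<1}" "x \<notin> \<rat>" "n \<ge> 1"
  shows "cf_digit 1 x \<le> cf_denom n x"
  using \<open>n \<ge> 1\<close>
proof (induction n rule: dec_induct)
  case base
  then show ?case using cf_denom_1[OF assms(1,2)] by simp
next
  case (step n)
  then show ?case using cf_denom_pos_mono[OF assms(1,2), of n] by linarith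
qed

section \<open>Lebesgue measure of the deviation sets\<close>

lemma AE_lborel_irrational: "AE x in lborel. x \<notin> (\<rat> :: real set)"
  by (intro AE_not_in countable_imp_null_set_lborel countable_rat)

definition deviation_set :: "real \<Rightarrow> nat \<Rightarrow> real set" where
  "deviation_set \<epsilon> n = {x \<in> {0..<1}.
    \<bar>ln (real_of_int (cf_denom n x)) / real n - pi\<^sup>2 / (12 * ln 2)\<bar> \<ge> \<epsilon>}"

lemma deviation_set_measurable [measurable]: "deviation_set \<epsilon> n \<in> sets borel"
  unfolding deviation_set_def by (rule deviation_set_borel)

lemma emeasure_deviation_set_finite: "emeasure lborel (deviation_set \<epsilon> n) < \<infinity>"
proof -
  have "emeasure lborel (deviation_set \<epsilon> n) \<le> emeasure lborel {0..<1::real}"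
    by (rule emeasure_mono) (auto simp: deviation_set_def)
  then show ?thesis by (auto intro: le_less_trans)
qed

lemma deviation_lower_bound:
  assumes "\<epsilon> > 0" "n \<ge> 1"
  shows "1 / 2 * exp (- (pi\<^sup>2 / (12 * ln 2) + \<epsilon>) * real n) \<le> measure lborel (deviation_set \<epsilon> n)"
proof -
  define L :: real where "L = pi\<^sup>2 / (12 * ln 2)"
  have L: "L \<ge> 0" by (simp add: L_def)
  define M where "M = exp ((L + \<epsilon>) * real n)"
  have M: "M \<ge> 1" using L assms by (simp add: M_def)
  \<comment> \<open>Here the first digit is at least \<open>M\<close>: the factor 2 covers the loss
    in the floor, as \<open>2 * M - 1 \<ge> M\<close>.\<close>
  have sub: "x \<in> deviation_set \<epsilon> n" if x: "x \<in> {0<..<1 / (2 * M)}" "x \<notin> \<rat>" for x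
  proof -
    have "1 / (2 * M) < 1" using M by simp
    then have x1: "x \<in> {0..<1}" using x(1) by auto
    have "2 * M < 1 / x" using x(1) M by (auto simp: field_simps)
    then have "M \<le> real_of_int (cf_digit 1 x)" using M by (simp add: cf_digit_def) linarith
    also have "\<dots> \<le> real_of_int (cf_denom n x)"
      using cf_denom_ge_digit_1[OF x1 x(2) \<open>n \<ge> 1\<close>] by simp
    finally have "(L + \<epsilon>) * real n \<le> ln (real_of_int (cf_denom n x))"
      unfolding M_def using less_le_trans[OF exp_gt_zero] by (subst ln_ge_iff) blast+
    then have "L + \<epsilon> \<le> ln (real_of_int (cf_denom n x)) / real n"
      using \<open>n \<ge> 1\<close> by (simp add: le_divide_eq)
    then show ?thesis using x1 unfolding deviation_set_def L_def by auto
  qed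
  have "emeasure lborel {0<..<1 / (2 * M)} \<le> emeasure lborel (deviation_set \<epsilon> n)"
  proof (rule emeasure_mono_AE)
    show "AE x in lborel. x \<in> {0<..<1 / (2 * M)} \<longrightarrow> x \<in> deviation_set \<epsilon> n"
      using AE_lborel_irrational by eventually_elim (use sub in blast)
  qed simp
  then have "measure lborel {0<..<1 / (2 * M)} \<le> measure lborel (deviation_set \<epsilon> n)"
    using emeasure_deviation_set_finite[of \<epsilon> n] unfolding measure_def
    by (intro enn2real_mono) auto
  moreover have "measure lborel {0<..<1 / (2 * M)} = 1 / 2 * inverse M"
    using M by (subst measure_lborel_Ioo) (simp_all add: inverse_eq_divide)
  moreover have "inverse M = exp (- (L + \<epsilon>) * real n)"
    unfolding M_def mult_minus_left exp_minus ..
  ultimately show ?thesis unfolding L_def by simp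
qed

text \<open>Markov's inequality for the Gauss measure, carried over to Lebesgue measure: since
  \<open>ln 2 * (1 + x) \<le> 2\<close>, the change of density costs at most a factor 2.\<close>

lemma emeasure_le_gauss_measure:
  assumes [measurable]: "A \<in> sets borel" "h \<in> borel_measurable borel"
    and "c \<ge> 0" and h: "\<And>x. x \<in> A \<Longrightarrow> x \<in> {0<..<1} \<Longrightarrow> x \<notin> \<rat> \<Longrightarrow> 1 \<le> c * h x"
    and "A \<subseteq> {0..<1}" and nonneg: "\<And>x. h x \<ge> 0"
  shows "emeasure lborel A \<le> ennreal (2 * c) * (\<integral>\<^sup>+x. ennreal (h x) \<partial>gauss_measure)"
proof -
  have "emeasure lborel A = (\<integral>\<^sup>+x. indicator A x \<partial>lborel)" by simp
  also have "\<dots> \<le> (\<integral>\<^sup>+x. ennreal (2 * c * h x / (ln 2 * (1 + x))) * indicator {0<..<1} x \<partial>lborel)"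
  proof (rule nn_integral_mono_AE)
    show "AE x in lborel. indicator A x
        \<le> ennreal (2 * c * h x / (ln 2 * (1 + x))) * indicator {0<..<1} x"
      using AE_lborel_irrational
    proof eventually_elim
      case (elim x)
      show ?case
      proof (cases "x \<in> A")
        case True
        have "x \<noteq> 0" using elim by auto
        then have x: "x \<in> {0<..<1}" using True \<open>A \<subseteq> {0..<1}\<close> by force
        have "ln 2 * (1 + x) \<le> 1 * 2"
          using x ln_le_minus_one[of 2] by (intro mult_mono) auto
        also have "\<dots> \<le> 2 * (c * h x)" using h[OF True x elim] by simp
        finally have "1 \<le> 2 * c * h x / (ln 2 * (1 + x))"
          using x by (simp add: le_divide_eq)
        then show ?thesis using x True by simp
      qed simp
    qed
  qed
  also have "\<dots> = (\<integral>\<^sup>+x. ennreal (2 * c * h x) \<partial>gauss_measure)"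
    by (rule nn_integral_gauss_measure[symmetric]) measurable
  also have "\<dots> = (\<integral>\<^sup>+x. ennreal (2 * c) * ennreal (h x) \<partial>gauss_measure)"
    using \<open>c \<ge> 0\<close> nonneg by (simp add: ennreal_mult)
  also have "\<dots> = ennreal (2 * c) * (\<integral>\<^sup>+x. ennreal (h x) \<partial>gauss_measure)"
    by (rule nn_integral_cmult) measurable
  finally show ?thesis .
qed

text \<open>The exponential Markov inequality for the corrected Birkhoff sum \<open>S n\<close>,
  with both tails handled together by
  \<open>exp (\<theta> * S n x) + exp (- \<theta> * S n x)\<close>.\<close>

lemma deviation_upper_bound:
  assumes "\<epsilon> > 0"
  obtains A \<alpha> where "A > 0" "\<alpha> > 0"
    "\<And>n. n \<ge> 1 \<Longrightarrow> measure lborel (deviation_set \<epsilon> n) \<le> A * exp (- \<alpha> * real n)"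
proof -
  define L :: real where "L = pi\<^sup>2 / (12 * ln 2)"
  define \<delta> where "\<delta> = \<epsilon> / 4"
  have "\<delta> > 0" using assms by (simp add: \<delta>_def)
  obtain u U C where u[measurable]: "u \<in> borel_measurable borel" and C: "C > 0"
    and U: "\<And>x. x \<in> {0<..<1} \<Longrightarrow> \<bar>u x\<bar> \<le> U"
    and moment: "\<And>\<theta> n. \<bar>\<theta>\<bar> \<le> 1 / 4 \<Longrightarrow>
      (\<integral>\<^sup>+x. ennreal (exp (\<theta> * (\<Sum>i<n. - ln ((gauss_map ^^ i) x) - L
          + u ((gauss_map ^^ i) x) - u ((gauss_map ^^ Suc i) x)))) \<partial>gauss_measure)
        \<le> ennreal (exp (real n * (\<bar>\<theta>\<bar> * \<delta> + C * \<theta>\<^sup>2)))"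
    by (rule exponential_moment_bound[OF \<open>\<delta> > 0\<close>, folded L_def]) (rule that; assumption)
  define S where "S n x = (\<Sum>i<n. - ln ((gauss_map ^^ i) x) - L
          + u ((gauss_map ^^ i) x) - u ((gauss_map ^^ Suc i) x))" for n x
  have [measurable]: "S n \<in> borel_measurable borel" for n
    unfolding S_def[abs_def] by measurable
  \<comment> \<open>The telescoped coboundary contributes at most \<open>2 * U\<close>, and the
    passage from \<open>ln (cf_denom n x)\<close> to the Birkhoff sum at most
    \<open>ln 2\<close>.\<close>
  define K where "K = 2 * U + ln 2"
  \<comment> \<open>The moment bound holds for \<open>\<theta> \<le> 1 / 4\<close>; the other entry
    ensures \<open>C * \<theta> \<le> \<epsilon> / 4\<close>. As
    \<open>\<delta> = \<epsilon> / 4\<close>, half of the gain \<open>\<theta> * \<epsilon>\<close>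
    survives.\<close>
  define \<theta> where "\<theta> = min (1 / 4) (\<epsilon> / (4 * C))"
  have \<theta>: "\<theta> > 0" "\<theta> \<le> 1 / 4" using assms C by (auto simp: \<theta>_def)
  have "C * \<theta> \<le> \<epsilon> / 4"
  proof -
    have "\<theta> \<le> \<epsilon> / (4 * C)" by (simp add: \<theta>_def)
    then show ?thesis using C by (simp add: field_simps)
  qed
  then have "\<theta> * (C * \<theta>) \<le> \<theta> * (\<epsilon> / 4)" using \<theta> by (intro mult_left_mono) auto
  then have exponent: "\<theta> * \<delta> + C * \<theta>\<^sup>2 - \<theta> * \<epsilon> \<le> - (\<theta> * \<epsilon> / 2)"
    by (simp add: \<delta>_def power2_eq_square algebra_simps)
  show ?thesis
  proof
    show "4 * exp (\<theta> * K) > 0" by simp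
    show "\<theta> * \<epsilon> / 2 > 0" using \<theta> assms by simp
    fix n :: nat assume n: "n \<ge> 1"
    \<comment> \<open>\<open>b\<close> bounds the exponential moment of either sign, and
      \<open>c\<close> is the reciprocal of the Markov threshold
      \<open>exp (\<theta> * (real n * \<epsilon> - K))\<close>.\<close>
    define b where "b = exp (real n * (\<theta> * \<delta> + C * \<theta>\<^sup>2))"
    define c where "c = exp (\<theta> * (K - real n * \<epsilon>))"
    have S: "real n * \<epsilon> - K \<le> \<bar>S n x\<bar>"
      if "x \<in> deviation_set \<epsilon> n" and x: "x \<in> {0<..<1}" "x \<notin> \<rat>" for x
    proof -
      define q where "q = ln (real_of_int (cf_denom n x))"
      have x0: "x \<in> {0..<1}" using x by auto
      have "\<epsilon> \<le> \<bar>q / real n - L\<bar>"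
        using that(1) by (simp add: deviation_set_def q_def L_def)
      then have "real n * \<epsilon> \<le> real n * \<bar>q / real n - L\<bar>" by (intro mult_left_mono) auto
      also have "\<dots> = \<bar>q - real n * L\<bar>"
        using n by (simp add: abs_mult_pos' right_diff_distrib flip: abs_mult)
      finally have q: "real n * \<epsilon> \<le> \<bar>q - real n * L\<bar>" .
      have "S n x = (\<Sum>i<n. - ln ((gauss_map ^^ i) x) - L) +
          (\<Sum>i<n. u ((gauss_map ^^ i) x) - u ((gauss_map ^^ Suc i) x))"
        unfolding S_def sum.distrib[symmetric] by (intro sum.cong) auto
      also have "(\<Sum>i<n. u ((gauss_map ^^ i) x) - u ((gauss_map ^^ Suc i) x))
          = u x - u ((gauss_map ^^ n) x)"
        using sum_lessThan_telescope'[of "\<lambda>i. u ((gauss_map ^^ i) x)" n] by simp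
      also have "(\<Sum>i<n. - ln ((gauss_map ^^ i) x) - L) = (\<Sum>i<n. - ln ((gauss_map ^^ i) x)) - real n * L"
        by (simp add: sum_subtractf)
      finally have "S n x = (\<Sum>i<n. - ln ((gauss_map ^^ i) x)) - real n * L + (u x - u ((gauss_map ^^ n) x))" .
      moreover have "(gauss_map ^^ n) x \<in> {0<..<1}"
        using gauss_orbit_irrational[OF x0 x(2), of n] by simp
      ultimately show ?thesis
        using q ln_cf_denom_approx[OF x0 x(2) n] U[OF x(1)] U[of "(gauss_map ^^ n) x"]
        unfolding K_def q_def by linarith
    qed
    have "emeasure lborel (deviation_set \<epsilon> n)
        \<le> ennreal (2 * c) * (\<integral>\<^sup>+x. ennreal (exp (\<theta> * S n x) + exp (- \<theta> * S n x)) \<partial>gauss_measure)"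
    proof (rule emeasure_le_gauss_measure)
      show "deviation_set \<epsilon> n \<subseteq> {0..<1}" by (auto simp: deviation_set_def)
      fix x assume x: "x \<in> deviation_set \<epsilon> n" "x \<in> {0<..<1}" "x \<notin> \<rat>"
      have "exp (\<theta> * (real n * \<epsilon> - K)) \<le> exp (\<theta> * \<bar>S n x\<bar>)"
        using S[OF x] \<theta> by simp
      also have "\<dots> \<le> exp (\<theta> * S n x) + exp (- \<theta> * S n x)"
        by (cases "S n x \<ge> 0") auto
      finally have "c * exp (\<theta> * (real n * \<epsilon> - K)) \<le> c * (exp (\<theta> * S n x) + exp (- \<theta> * S n x))"
        by (rule mult_left_mono) (simp add: c_def)
      moreover have "c * exp (\<theta> * (real n * \<epsilon> - K)) = 1"
        by (simp add: c_def algebra_simps flip: exp_add)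
      ultimately show "1 \<le> c * (exp (\<theta> * S n x) + exp (- \<theta> * S n x))" by simp
    qed (auto simp: c_def add_nonneg_nonneg)
    also have "(\<integral>\<^sup>+x. ennreal (exp (\<theta> * S n x) + exp (- \<theta> * S n x)) \<partial>gauss_measure)
        = (\<integral>\<^sup>+x. ennreal (exp (\<theta> * S n x)) \<partial>gauss_measure)
          + (\<integral>\<^sup>+x. ennreal (exp (- \<theta> * S n x)) \<partial>gauss_measure)"
      by (subst nn_integral_add[symmetric]) auto
    also have "\<dots> \<le> ennreal b + ennreal b"
      using moment[of \<theta> n] moment[of "- \<theta>" n] \<theta> unfolding S_def[symmetric] b_def
      by (intro add_mono) auto
    also have "ennreal (2 * c) * (ennreal b + ennreal b) = ennreal (4 * c * b)"
      by (simp add: b_def c_def flip: ennreal_plus ennreal_mult)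
    finally have "emeasure lborel (deviation_set \<epsilon> n) \<le> ennreal (4 * c * b)"
      by (simp add: mult_left_mono)
    then have "measure lborel (deviation_set \<epsilon> n) \<le> 4 * c * b"
      unfolding measure_def by (intro enn2real_leI) (auto simp: b_def c_def)
    \<comment> \<open>The 4 combines the factor 2 from the density comparison with the two tails;
      the part of \<open>c\<close> free of \<open>n\<close> joins the constant.\<close>
    also have "4 * c * b = 4 * exp (\<theta> * K) * exp (real n * (\<theta> * \<delta> + C * \<theta>\<^sup>2 - \<theta> * \<epsilon>))"
      by (simp add: b_def c_def algebra_simps flip: exp_add)
    also have "\<dots> \<le> 4 * exp (\<theta> * K) * exp (real n * - (\<theta> * \<epsilon> / 2))"
      using exponent by (intro mult_left_mono exp_mono) auto
    finally show "measure lborel (deviation_set \<epsilon> n) \<le> 4 * exp (\<theta> * K) * exp (- (\<theta> * \<epsilon> / 2) * real n)"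
      by (simp add: mult.commute)
  qed
qed

theorem theorem2p5:
  fixes \<epsilon> :: real
  assumes "\<epsilon> > 0"
  shows "\<exists>A B \<alpha> \<beta> :: real. A > 0 \<and> B > 0 \<and> \<alpha> > 0 \<and> \<beta> > 0 \<and>
    (\<forall>n::nat. n \<ge> 1 \<longrightarrow>
      B * exp (- \<beta> * real n)
        \<le> measure lebesgue {x \<in> {0..<1}.
            \<bar>ln (real_of_int (cf_denom n x)) / real n - pi\<^sup>2 / (12 * ln 2)\<bar> \<ge> \<epsilon>} \<and>
      measure lebesgue {x \<in> {0..<1}.
            \<bar>ln (real_of_int (cf_denom n x)) / real n - pi\<^sup>2 / (12 * ln 2)\<bar> \<ge> \<epsilon>}
        \<le> A * exp (- \<alpha> * real n))"
proof -
  obtain A \<alpha> where upper: "A > 0" "\<alpha> > 0"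
    "\<And>n. n \<ge> 1 \<Longrightarrow> measure lborel (deviation_set \<epsilon> n) \<le> A * exp (- \<alpha> * real n)"
    using deviation_upper_bound[OF assms] by blast
  \<comment> \<open>The deviation sets are Borel, so completing the measure does not change their
    size.\<close>
  have "measure lebesgue (deviation_set \<epsilon> n) = measure lborel (deviation_set \<epsilon> n)" for n
    by (rule measure_completion) simp
  moreover have "pi\<^sup>2 / (12 * ln 2) + \<epsilon> > 0"
    using assms by (intro add_nonneg_pos) auto
  ultimately show ?thesis
    using upper deviation_lower_bound[OF assms] unfolding deviation_set_def[symmetric]
    by (intro exI[of _ A] exI[of _ "1 / 2"] exI[of _ \<alpha>] exI[of _ "pi\<^sup>2 / (12 * ln 2) + \<epsilon>"]) auto
qed

end
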